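(* Suppose that $s$ and $k$ are natural numbers with $k\ge 3$ and $s\ge k^2-k+1$. Then for each $\varepsilon>0$, one has $$J_{s,k}(X)\ll X^{2s-\frac12k(k+1)+\varepsilon}.$$
   Context: For natural numbers $s,k$ and a real number $X$, $J_{s,k}(X)$ denotes the number of integral solutions of the system $x_1^j+\ldots+x_s^j=y_1^j+\ldots+y_s^j$ $(1\le j\le k)$ with $1\le x_i,y_i\le X$ $(1\le i\le s)$. The notation $A\ll B$ means $|A|\le CB$ for all sufficiently large $X$, where the implicit constant $C$ may depend on $s$, $k$ and $\varepsilon$ only. *)

theory Defs
  imports Complex_Main "HOL-Library.FuncSet" "HOL-Library.Landau_Symbols"
begin

text \<open>
  An \<open>s\<close>-tuple is an extensional function on \<open>{1..s}\<close>, so that distinct tuples are distinct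
  functions and \<^const>\<open>card\<close> counts them correctly.
\<close>

definition vinogradov_solutions :: "nat \<Rightarrow> nat \<Rightarrow> real \<Rightarrow> ((nat \<Rightarrow> int) \<times> (nat \<Rightarrow> int)) set" where
  "vinogradov_solutions s k X =
     {(x, y). x \<in> {1..s} \<rightarrow>\<^sub>E {n. 1 \<le> n \<and> real_of_int n \<le> X} \<and>
              y \<in> {1..s} \<rightarrow>\<^sub>E {n. 1 \<le> n \<and> real_of_int n \<le> X} \<and>
              (\<forall>j\<in>{1..k}. (\<Sum>i=1..s. x i ^ j) = (\<Sum>i=1..s. y i ^ j))}"

definition J :: "nat \<Rightarrow> nat \<Rightarrow> real \<Rightarrow> nat" where
  "J s k X = card (vinogradov_solutions s k X)"

text \<open>The solution set is finite, so \<open>J\<close> is a genuine count.\<close>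

lemma finite_vinogradov_solutions: "finite (vinogradov_solutions s k X)"
proof -
  have eq: "{n::int. 1 \<le> n \<and> real_of_int n \<le> X} = {1..\<lfloor>X\<rfloor>}"
    by (auto simp: le_floor_iff)
  have fin: "finite ({1..s} \<rightarrow>\<^sub>E {n::int. 1 \<le> n \<and> real_of_int n \<le> X})"
    unfolding eq by (intro finite_PiE) auto
  show ?thesis
    by (rule finite_subset[OF _ finite_cartesian_product[OF fin fin]])
      (auto simp: vinogradov_solutions_def)
qed

end

theory Submission
  imports Defs "HOL-Analysis.Convex" "HOL-Computational_Algebra.Polynomial" "HOL-Computational_Algebra.Primes"
begin

text \<open>
  The argument is a \<open>p\<close>-adic version, for a fixed prime \<open>p > k\<close>, of the bilinear proof of
  \<open>\<ell>\<^sup>2\<close> decoupling for the moment curve due to Guo, Li, Yung and Zorin-Kranich. It proceeds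
  by induction on \<open>k\<close> and reaches the critical number \<open>k (k + 1) / 2\<close> of variables; larger
  numbers of variables follow by bounding the surplus factors trivially.

  Write \<open>r\<^sub>j = j (j + 1) / 2\<close>, and let \<open>I\<close>, \<open>I'\<close> be residue classes modulo \<open>p\<^sup>a\<close> and \<open>p\<^sup>b\<close> that
  are disjoint modulo \<open>p\<close>. In the mean value of \<open>|f\<^sub>I|\<close> and \<open>|f\<^sub>I\<^sub>'|\<close> to the powers \<open>2 r\<^sub>l\<close> and
  \<open>2 (r\<^sub>k - r\<^sub>l)\<close>, the factor \<open>|f\<^sub>I\<^sub>'|\<close> is constant along the cosets of an \<open>l\<close>-dimensional subgroup on
  which the frequencies of \<open>I\<close> again form a nondegenerate curve, so decoupling in dimension
  \<open>l < k\<close> refines \<open>I\<close> to classes modulo \<open>p\<^sup>c\<close> with \<open>l c = (k - l + 1) b\<close>. H"older's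
  inequality then passes to the exponents \<open>l - 1\<close> and \<open>k - l\<close>, the latter with the two classes
  exchanged. If the decoupling constant really had a positive exponent, iterating this would gain
  arbitrarily large powers of \<open>p\<close>, which is absurd.
\<close>

section \<open>Mean inequalities\<close>

text \<open>The prime stays fixed while the scale p^m grows, so factors depending only on p and k
  are harmless, such as the number p^2 of pairs of classes lost in passing from linear to bilinear
  estimates. The relation l c = (k - l + 1) b balances two precisions: modulo a high power of p, l
  independent combinations of the k coordinates can be made flat to order k - l at the class I', so
  that they vary over it only by multiples of p^((k - l + 1) b), whereas decoupling in dimension l
  down to p^c needs p^(l c). Because r_j is quadratic in j, the exponents in the Hoelder step match
  exactly. A round redistributes the gains of the indices 1, ..., k - 1 without changing their sum,
  while index 0, the plain linear estimate, adds a fixed share of the exponent each time. The total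
  thus grows linearly in the number of rounds, but returning to coarse classes costs a power of p^b
  that does not depend on that number. The absurdity takes the form of a descent: all exponents
  above a threshold can be lowered by one common amount, starting from the trivial exponent
  r_k.\<close>

lemma convex_on_power_nonneg: "convex_on {0..} (\<lambda>x::real. x ^ n)"
proof (cases "even n")
  case True
  show ?thesis by (rule convex_on_subset[OF convex_power_even[OF True]]) auto
qed (rule convex_power_odd)

text \<open>The triangle inequality in weighted L^r, with \<open>e t\<close> in place of the norm of
  \<open>F t\<close>, so that no root occurs. It is Jensen's inequality for the r-th power at the
  points \<open>F t x / e t\<close> with weights \<open>e t / S\<close>.\<close>

lemma minkowski_power:
  fixes F :: "'t \<Rightarrow> 'x \<Rightarrow> real"
  assumes fin: "finite T" and r: "r \<ge> 1"
    and w: "\<And>x. x \<in> A \<Longrightarrow> w x \<ge> 0"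
    and F: "\<And>t x. t \<in> T \<Longrightarrow> x \<in> A \<Longrightarrow> F t x \<ge> 0"
    and e: "\<And>t. t \<in> T \<Longrightarrow> e t \<ge> 0"
    and le: "\<And>t. t \<in> T \<Longrightarrow> (\<Sum>x\<in>A. w x * F t x ^ r) \<le> e t ^ r"
  shows "(\<Sum>x\<in>A. w x * (\<Sum>t\<in>T. F t x) ^ r) \<le> (\<Sum>t\<in>T. e t) ^ r"
proof (cases "finite A")
  case False
  then show ?thesis using e by (simp add: sum_nonneg)
next
  case finA: True
  define T0 where "T0 = {t \<in> T. e t > 0}"
  have T0: "finite T0" "T0 \<subseteq> T" using fin by (auto simp: T0_def)
  define S where "S = (\<Sum>t\<in>T0. e t)"
  have S_eq: "(\<Sum>t\<in>T. e t) = S"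
    unfolding S_def by (intro sum.mono_neutral_right) (use fin e in \<open>force simp: T0_def\<close>)+
  have zero: "w x * F t x ^ r = 0" if "t \<in> T - T0" "x \<in> A" for t x
  proof -
    have "e t = 0" using that e[of t] by (auto simp: T0_def)
    then have "(\<Sum>x\<in>A. w x * F t x ^ r) \<le> 0" using le[of t] r that by (simp add: power_0_left)
    moreover have "0 \<le> w x * F t x ^ r" if "x \<in> A" for x using w F that \<open>t \<in> T - T0\<close> by auto
    ultimately have "\<forall>x\<in>A. w x * F t x ^ r = 0"
      using finA by (subst sum_nonneg_eq_0_iff[symmetric]) (auto intro!: antisym sum_nonneg)
    then show ?thesis using that by blast
  qed
  have restr: "w x * (\<Sum>t\<in>T. F t x) ^ r = w x * (\<Sum>t\<in>T0. F t x) ^ r" if "x \<in> A" for x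
  proof (cases "w x = 0")
    case False
    have "(\<Sum>t\<in>T. F t x) = (\<Sum>t\<in>T0. F t x)"
      by (intro sum.mono_neutral_right) (use fin T0 zero that False in auto)
    then show ?thesis by simp
  qed simp
  show ?thesis
  proof (cases "T0 = {}")
    case True
    then have "w x * (\<Sum>t\<in>T. F t x) ^ r = 0" if "x \<in> A" for x
      using restr[OF that] r by (simp add: power_0_left)
    then have "(\<Sum>x\<in>A. w x * (\<Sum>t\<in>T. F t x) ^ r) = 0" by (rule sum.neutral[OF ballI])
    then show ?thesis using S_eq True r by (simp add: S_def power_0_left)
  next
    case False
    have Spos: "S > 0" unfolding S_def using T0 False by (intro sum_pos) (auto simp: T0_def)
    have epos: "e t > 0" if "t \<in> T0" for t using that by (simp add: T0_def)
    have conv: "(\<Sum>t\<in>T0. F t x) ^ r \<le> S ^ r * (\<Sum>t\<in>T0. (e t / S) * (F t x / e t) ^ r)" if "x \<in> A" for x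
    proof -
      have "(\<Sum>t\<in>T0. (e t / S) *\<^sub>R (F t x / e t)) ^ r \<le> (\<Sum>t\<in>T0. (e t / S) * (F t x / e t) ^ r)"
      proof (rule convex_on_sum[OF _ _ convex_on_power_nonneg])
        show "(\<Sum>t\<in>T0. e t / S) = 1" using Spos by (simp add: S_def sum_divide_distrib[symmetric])
        show "F t x / e t \<in> {0..}" if "t \<in> T0" for t
          using epos[OF that] F[of t x] T0 that \<open>x \<in> A\<close> by auto
        show "0 \<le> e t / S" if "t \<in> T0" for t
          using epos[OF that] Spos by simp
      qed (use T0 False in auto)
      moreover have "(\<Sum>t\<in>T0. (e t / S) *\<^sub>R (F t x / e t)) = (\<Sum>t\<in>T0. F t x) / S"
        unfolding sum_divide_distrib by (intro sum.cong) (use epos in force)+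
      ultimately have "S ^ r * ((\<Sum>t\<in>T0. F t x) / S) ^ r \<le> S ^ r * (\<Sum>t\<in>T0. (e t / S) * (F t x / e t) ^ r)"
        using Spos by (intro mult_left_mono) auto
      then show ?thesis using Spos by (simp add: power_divide)
    qed
    have "(\<Sum>x\<in>A. w x * (\<Sum>t\<in>T. F t x) ^ r) = (\<Sum>x\<in>A. w x * (\<Sum>t\<in>T0. F t x) ^ r)"
      by (intro sum.cong refl restr)
    also have "\<dots> \<le> (\<Sum>x\<in>A. w x * (S ^ r * (\<Sum>t\<in>T0. (e t / S) * (F t x / e t) ^ r)))"
      by (intro sum_mono mult_left_mono conv w)
    also have "\<dots> = S ^ r * (\<Sum>t\<in>T0. e t / S / e t ^ r * (\<Sum>x\<in>A. w x * F t x ^ r))"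
      unfolding sum_distrib_left by (subst sum.swap) (simp add: power_divide mult_ac)
    also have "\<dots> \<le> S ^ r * (\<Sum>t\<in>T0. e t / S / e t ^ r * e t ^ r)"
    proof (intro mult_left_mono sum_mono)
      fix t assume t: "t \<in> T0"
      show "0 \<le> e t / S / e t ^ r" using epos[OF t] Spos by simp
    qed (use Spos T0 le in auto)
    also have "(\<Sum>t\<in>T0. e t / S / e t ^ r * e t ^ r) = (\<Sum>t\<in>T0. e t / S)"
      by (intro sum.cong) (use epos in force)+
    also have "S ^ r * (\<Sum>t\<in>T0. e t / S) = S ^ r" using Spos by (simp add: S_def sum_divide_distrib[symmetric])
    finally show ?thesis by (simp add: S_eq)
  qed
qed

text \<open>The arithmetic-geometric mean inequality for \<open>i\<close> copies of \<open>x\<close>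
  and \<open>j\<close> copies of \<open>y\<close>; \<open>z\<close> is their geometric mean.\<close>

lemma weighted_am_gm:
  fixes x y z :: real
  assumes "x \<ge> 0" "y \<ge> 0" "z \<ge> 0" and ij: "i \<ge> 1" "j \<ge> 1" and "z ^ (i + j) = x ^ i * y ^ j"
  shows "real (i + j) * z \<le> real i * x + real j * y"
proof -
  define S where "S = {..<i+j}"
  define u where "u = (\<lambda>t. if t < i then x else y)"
  have prodS: "(\<Prod>t\<in>S. u t) = z ^ (i + j)"
  proof -
    have "S = {..<i} \<union> {i..<i+j}" by (auto simp: S_def)
    then have "(\<Prod>t\<in>S. u t) = (\<Prod>t<i. u t) * (\<Prod>t\<in>{i..<i+j}. u t)"
      by (simp only:) (rule prod.union_disjoint, auto)
    then show ?thesis using assms by (simp add: u_def)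
  qed
  have sumS: "(\<Sum>t\<in>S. u t / card S) = (real i * x + real j * y) / real (i + j)"
  proof -
    have "S = {..<i} \<union> {i..<i+j}" by (auto simp: S_def)
    then have "(\<Sum>t\<in>S. u t) = (\<Sum>t<i. u t) + (\<Sum>t\<in>{i..<i+j}. u t)"
      by (simp only:) (rule sum.union_disjoint, auto)
    then have "(\<Sum>t\<in>S. u t) = real i * x + real j * y" by (simp add: u_def)
    then show ?thesis by (simp add: sum_divide_distrib[symmetric] S_def)
  qed
  have "(\<Prod>t\<in>S. u t) powr (1 / card S) \<le> (\<Sum>t\<in>S. u t / card S)"
    by (rule arith_geom_mean) (use assms in \<open>auto simp: S_def u_def lessThan_empty_iff\<close>)
  moreover have "(z ^ (i + j)) powr (1 / card S) = z"
  proof (cases "z = 0")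
    case False
    then have "(z ^ (i + j)) powr (1 / card S) = (z powr real (i + j)) powr (1 / card S)"
      using assms by (subst powr_realpow) auto
    also have "\<dots> = z powr (real (i + j) * (1 / card S))" by (rule powr_powr)
    also have "real (i + j) * (1 / card S) = 1" using assms by (simp add: S_def)
    finally show ?thesis using assms False by simp
  qed (use ij in simp)
  ultimately show ?thesis using assms by (simp add: prodS sumS field_simps)
qed

lemma holder_power:
  fixes X Y Z :: "'x \<Rightarrow> real"
  assumes nonneg: "\<And>x. x \<in> A \<Longrightarrow> X x \<ge> 0" "\<And>x. x \<in> A \<Longrightarrow> Y x \<ge> 0" "\<And>x. x \<in> A \<Longrightarrow> Z x \<ge> 0"
    and ij: "i \<ge> 1" "j \<ge> 1"
    and eq: "\<And>x. x \<in> A \<Longrightarrow> Z x ^ (i + j) = X x ^ i * Y x ^ j"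
  shows "(\<Sum>x\<in>A. Z x) ^ (i + j) \<le> (\<Sum>x\<in>A. X x) ^ i * (\<Sum>x\<in>A. Y x) ^ j"
proof (cases "finite A")
  case False
  then show ?thesis using ij by (simp add: power_0_left)
next
  case fin: True
  define a where "a = (\<Sum>x\<in>A. X x)"
  define b where "b = (\<Sum>x\<in>A. Y x)"
  have ab: "a \<ge> 0" "b \<ge> 0" using nonneg by (auto simp: a_def b_def intro: sum_nonneg)
  show ?thesis
  proof (cases "a = 0 \<or> b = 0")
    case True
    then have "\<forall>x\<in>A. X x = 0 \<or> Y x = 0"
      using fin nonneg unfolding a_def b_def by (auto simp: sum_nonneg_eq_0_iff)
    have "Z x = 0" if "x \<in> A" for x
    proof -
      have "X x ^ i * Y x ^ j = 0" using \<open>\<forall>x\<in>A. X x = 0 \<or> Y x = 0\<close> that ij by auto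
      then show ?thesis using eq[OF that] ij by (simp del: mult_eq_0_iff)
    qed
    then show ?thesis using ij ab by (simp add: a_def b_def power_0_left)
  next
    case False
    then have pos: "a > 0" "b > 0" using ab by auto
    \<comment> \<open>\<open>t\<close> is the claimed bound for the sum of \<open>Z\<close>. The
      factors \<open>t / a\<close> and \<open>t / b\<close> make both arguments of
      \<open>weighted_am_gm\<close> sum to \<open>t\<close> and leave the required product
      unchanged.\<close>
    define t where "t = root (i + j) (a ^ i * b ^ j)"
    have tpos: "t > 0" using pos ij by (simp add: t_def real_root_gt_zero)
    have tpow: "t ^ (i + j) = a ^ i * b ^ j" using pos ij by (simp add: t_def)
    have "real (i + j) * Z x \<le> real i * (t / a * X x) + real j * (t / b * Y x)" if "x \<in> A" for x
    proof (rule weighted_am_gm)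
      show "Z x ^ (i + j) = (t / a * X x) ^ i * (t / b * Y x) ^ j"
      proof -
        have "(t / a * X x) ^ i * (t / b * Y x) ^ j = t ^ (i + j) / (a ^ i * b ^ j) * (X x ^ i * Y x ^ j)"
          by (simp add: power_mult_distrib power_divide power_add)
        then show ?thesis using eq[OF that] pos by (simp add: tpow)
      qed
    qed (use nonneg that tpos pos ij in auto)
    then have "(\<Sum>x\<in>A. real (i + j) * Z x) \<le> (\<Sum>x\<in>A. real i * (t / a * X x) + real j * (t / b * Y x))"
      by (intro sum_mono) auto
    also have "\<dots> = real i * (t / a * a) + real j * (t / b * b)"
      by (simp add: sum.distrib sum_distrib_left a_def b_def)
    also have "\<dots> = real (i + j) * t" using pos by (simp add: algebra_simps)
    finally have "(\<Sum>x\<in>A. Z x) \<le> t" using ij by (simp add: sum_distrib_left[symmetric] del: of_nat_add)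
    then have "(\<Sum>x\<in>A. Z x) ^ (i + j) \<le> t ^ (i + j)"
      using nonneg by (intro power_mono sum_nonneg) auto
    then show ?thesis by (simp add: tpow a_def b_def)
  qed
qed

section \<open>Nondegenerate curves modulo p\<close>

text \<open>Unlike the moment curve itself, this class is stable under rescaling a residue class and
  under the projections to lower dimension.\<close>

definition curve :: "int \<Rightarrow> nat \<Rightarrow> (nat \<Rightarrow> int poly) \<Rightarrow> bool" where
  "curve p k \<gamma> \<longleftrightarrow> (\<forall>i\<in>{1..k}. [:p:] dvd \<gamma> i - monom 1 i)"

lemma dvd_pcompose: "[:c:] dvd U \<Longrightarrow> [:c:] dvd pcompose U q" for c :: "'a::comm_ring_1"
proof -
  assume "[:c:] dvd U"
  then obtain V where "U = [:c:] * V" by (elim dvdE)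
  then have "pcompose U q = [:c:] * pcompose V q" by (simp add: pcompose_mult pcompose_smult)
  then show ?thesis by (metis dvd_triv_left)
qed

text \<open>Modulo \<open>p\<close>, \<open>V\<close> is a unit among the power series, so a power
  of the variable dividing \<open>V * W\<close> divides \<open>W\<close>.\<close>

lemma const_dvd_of_mult:
  fixes V W :: "int poly"
  assumes p: "prime p" and V: "\<not> p dvd coeff V 0"
    and VW: "\<And>i. i < l \<Longrightarrow> p dvd coeff (V * W) i"
  shows "i < l \<Longrightarrow> p dvd coeff W i"
proof (induction i rule: less_induct)
  case (less i)
  have "coeff (V * W) i = (\<Sum>j\<le>i. coeff V j * coeff W (i - j))" by (simp add: coeff_mult)
  also have "\<dots> = coeff V 0 * coeff W i + (\<Sum>j\<in>{..i} - {0}. coeff V j * coeff W (i - j))"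
    by (subst sum.remove[of _ 0]) auto
  finally have "coeff V 0 * coeff W i = coeff (V * W) i - (\<Sum>j\<in>{..i} - {0}. coeff V j * coeff W (i - j))"
    by simp
  also have "p dvd \<dots>"
  proof (rule dvd_diff)
    show "p dvd coeff (V * W) i" using VW less.prems .
    show "p dvd (\<Sum>j\<in>{..i} - {0}. coeff V j * coeff W (i - j))"
      using less by (intro dvd_sum dvd_mult) auto
  qed
  finally show ?case using prime_dvd_multD[OF p] V by blast
qed

text \<open>The derivative of \<open>H\<close> has degree less than \<open>k\<close> but \<open>k\<close> zeros modulo \<open>p\<close> with multiplicity,
  namely \<open>t1\<close> (\<open>k - l\<close> times) and \<open>t0\<close> (\<open>l\<close> times).\<close>

lemma poly_jets_zero_mod:
  fixes v :: "nat \<Rightarrow> int"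
  assumes p: "prime p" and k: "int k < p" and l: "l \<le> k" and t: "\<not> p dvd t0 - t1"
    and H: "H = (\<Sum>i=1..k. monom (v i) i)"
    and j1: "\<And>j. j \<in> {1..k-l} \<Longrightarrow> p dvd coeff (pcompose H [:t1, 1:]) j"
    and j0: "\<And>j. j \<in> {1..l} \<Longrightarrow> p dvd coeff (pcompose H [:t0, 1:]) j"
    and i: "i \<in> {1..k}"
  shows "p dvd v i"
proof -
  define G where "G = pderiv H"
  have coeffH: "coeff H j = (if j \<in> {1..k} then v j else 0)" for j
    by (auto simp: H coeff_sum)
  have coeffG: "coeff G j = int (Suc j) * coeff H (Suc j)" for j
    by (simp add: G_def coeff_pderiv)
  have degG: "coeff G j = 0" if "j \<ge> k" for j using that by (simp add: coeffG coeffH)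
  have comp: "coeff (pcompose G [:c, 1:]) j = int (Suc j) * coeff (pcompose H [:c, 1:]) (Suc j)" for c j
  proof -
    have "pderiv (pcompose H [:c, 1:]) = pcompose G [:c, 1:]"
      by (simp add: pderiv_pcompose G_def pderiv_pCons)
    then show ?thesis by (metis coeff_pderiv)
  qed
  define G' where "G' = pcompose G [:t1, 1:]"
  \<comment> \<open>Modulo \<open>p\<close> the derivative recentred at \<open>t1\<close> is x^(k -
    l) times \<open>G1\<close>. Around \<open>t0\<close> the first factor becomes (x + z)^(k - l), a
    unit power series since \<open>p\<close> does not divide \<open>z\<close>; so the vanishing
    there falls on \<open>W\<close>, which has no coefficients from \<open>l\<close> on.\<close>
  define G1 where "G1 = poly_shift (k - l) G'"
  define z where "z = t0 - t1"
  have degG': "coeff G' j = 0" if "j \<ge> k" for j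
  proof (rule coeff_eq_0)
    have "degree G' \<le> degree G * degree [:t1, 1:]" unfolding G'_def by (rule degree_pcompose_le)
    then have "degree G' \<le> degree G" by simp
    moreover have "degree G \<le> k - 1" using degG by (intro degree_le) auto
    ultimately show "degree G' < j" using that i by auto
  qed
  have coG1: "coeff G1 j = coeff G' (j + (k - l))" for j
    by (simp add: G1_def coeff_poly_shift)
  have GG: "[:p:] dvd G' - monom 1 (k - l) * G1"
    unfolding const_poly_dvd_iff
  proof
    fix n
    show "p dvd coeff (G' - monom 1 (k - l) * G1) n"
    proof (cases "n < k - l")
      case True
      then show ?thesis using j1[of "Suc n"] by (simp add: coeff_monom_mult G'_def comp)
    next
      case False
      then show ?thesis by (simp add: coeff_monom_mult coG1)
    qed
  qed
  define W where "W = pcompose G1 [:z, 1:]"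
  have G'z: "pcompose G' [:z, 1:] = pcompose G [:t0, 1:]"
    by (simp add: G'_def pcompose_assoc[symmetric] pcompose_pCons z_def)
  have mz: "pcompose (monom 1 (k - l)) [:z, 1:] = [:z, 1:] ^ (k - l)"
    by (simp add: pcompose_altdef poly_monom map_poly_monom)
  have dvd2: "[:p:] dvd pcompose G [:t0, 1:] - [:z, 1:] ^ (k - l) * W"
    using dvd_pcompose[OF GG, of "[:z, 1:]"] by (simp add: pcompose_diff pcompose_mult G'z mz W_def)
  have "p dvd coeff W j" if "j < l" for j
  proof (rule const_dvd_of_mult[OF p _ _ that])
    have "coeff ([:z, 1:] ^ (k - l)) 0 = z ^ (k - l)" by (simp add: coeff_0_power)
    then show "\<not> p dvd coeff ([:z, 1:] ^ (k - l)) 0"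
      using t p by (auto simp: z_def dest: prime_dvd_power)
    show "p dvd coeff ([:z, 1:] ^ (k - l) * W) i" if "i < l" for i
    proof -
      have *: "p dvd coeff (pcompose G [:t0, 1:]) i - coeff ([:z, 1:] ^ (k - l) * W) i"
        using dvd2 unfolding const_poly_dvd_iff by simp
      have "p dvd coeff (pcompose G [:t0, 1:]) i" using j0[of "Suc i"] that by (simp add: comp)
      from dvd_diff[OF this *] show ?thesis by simp
    qed
  qed
  moreover have "coeff W j = 0" if "j \<ge> l" for j
  proof (cases "l = 0")
    case True
    have "G1 = 0" by (rule poly_eqI) (use True degG' in \<open>simp add: coG1\<close>)
    then show ?thesis by (simp add: W_def)
  next
    case False
    have "degree W \<le> degree G1 * degree [:z, 1:]" unfolding W_def by (rule degree_pcompose_le)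
    moreover have "degree G1 \<le> l - 1"
      by (rule degree_le) (use degG' l False in \<open>auto simp: coG1\<close>)
    ultimately show ?thesis using that False by (intro coeff_eq_0) simp
  qed
  ultimately have "[:p:] dvd W" unfolding const_poly_dvd_iff by (metis dvd_0_right not_le_imp_less)
  then have "[:p:] dvd pcompose W [:-z, 1:]" by (rule dvd_pcompose)
  also have "pcompose W [:-z, 1:] = G1" by (simp add: W_def pcompose_assoc[symmetric] pcompose_pCons)
  finally have "[:p:] dvd (G' - monom 1 (k - l) * G1) + monom 1 (k - l) * G1"
    using GG by (intro dvd_add dvd_mult)
  then have "[:p:] dvd pcompose G' [:-t1, 1:]" by (intro dvd_pcompose) simp
  also have "pcompose G' [:-t1, 1:] = G" by (simp add: G'_def pcompose_assoc[symmetric] pcompose_pCons)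
  finally have "p dvd coeff G (i - 1)" unfolding const_poly_dvd_iff by blast
  then have "p dvd int i * v i" using i by (simp add: coeffG coeffH Suc_diff_le)
  \<comment> \<open>Here \<open>int k < p\<close> enters: the factors \<open>i\<close> produced by
    differentiation are invertible modulo \<open>p\<close>.\<close>
  moreover have "\<not> p dvd int i" using i k by (auto dest!: zdvd_imp_le)
  ultimately show ?thesis using p prime_dvd_multD[OF p] by blast
qed

text \<open>A linear map injective modulo \<open>p\<close> is injective modulo every power of
  \<open>p\<close>, by dividing out \<open>p\<close> repeatedly; as an injective self-map of a
  finite set it is onto. Counting takes the place of a determinant.\<close>

lemma unimodular_mod_prime_power:
  fixes A :: "nat \<Rightarrow> nat \<Rightarrow> int" and p :: int
  assumes p: "p > 1"
    and inj: "\<And>v i. (\<And>j. j \<in> {1..k} \<Longrightarrow> p dvd (\<Sum>i=1..k. v i * A i j)) \<Longrightarrow> i \<in> {1..k} \<Longrightarrow> p dvd v i"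
  shows "\<exists>v. \<forall>j\<in>{1..k}. p ^ M dvd (\<Sum>i=1..k. v i * A i j) - w j"
proof -
  have injM: "p ^ N dvd v i" if "\<And>j. j \<in> {1..k} \<Longrightarrow> p ^ N dvd (\<Sum>i=1..k. v i * A i j)" "i \<in> {1..k}" for N v i
    using that
  proof (induction N arbitrary: v i)
    case (Suc N)
    have "p dvd v i" if "i \<in> {1..k}" for i
      using inj[of v i] Suc.prems(1) that by (meson dvd_power dvd_trans zero_less_Suc)
    then have v: "v i = p * (v i div p)" if "i \<in> {1..k}" for i using that by simp
    have "p ^ N dvd (\<Sum>i=1..k. v i div p * A i j)" if "j \<in> {1..k}" for j
    proof -
      have "(\<Sum>i=1..k. v i * A i j) = p * (\<Sum>i=1..k. v i div p * A i j)"
        unfolding sum_distrib_left by (intro sum.cong refl) (use v in \<open>metis mult.assoc\<close>)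
      then show ?thesis using Suc.prems(1)[OF that] p by simp
    qed
    then have "p ^ N dvd v i div p" by (rule Suc.IH[OF _ Suc.prems(2)])
    then have "p * p ^ N dvd p * (v i div p)" by (rule mult_dvd_mono[OF dvd_refl])
    then show ?case using v[OF Suc.prems(2)] by simp
  qed simp
  define B where "B = {1..k} \<rightarrow>\<^sub>E {0..<p ^ M}"
  define \<Phi> where "\<Phi> = (\<lambda>v. \<lambda>j\<in>{1..k}. (\<Sum>i=1..k. v i * A i j) mod p ^ M)"
  have finB: "finite B" unfolding B_def by (intro finite_PiE) auto
  have pM: "p ^ M > 0" using p by simp
  have sub: "\<Phi> ` B \<subseteq> B" using pM by (auto simp: \<Phi>_def B_def)
  have "inj_on \<Phi> B"
  proof (rule inj_onI)
    fix u v assume uv: "u \<in> B" "v \<in> B" "\<Phi> u = \<Phi> v"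
    have "p ^ M dvd (\<Sum>i=1..k. (u i - v i) * A i j)" if "j \<in> {1..k}" for j
    proof -
      have "(\<Sum>i=1..k. u i * A i j) mod p ^ M = (\<Sum>i=1..k. v i * A i j) mod p ^ M"
        using fun_cong[OF uv(3), of j] that by (simp add: \<Phi>_def)
      then show ?thesis by (simp add: mod_eq_dvd_iff left_diff_distrib sum_subtractf)
    qed
    then have "p ^ M dvd u i - v i" if "i \<in> {1..k}" for i using that injM[of M "\<lambda>i. u i - v i"] by blast
    moreover have "u i \<in> {0..<p^M}" "v i \<in> {0..<p^M}" if "i \<in> {1..k}" for i
      using uv that by (auto simp: B_def)
    ultimately have "u i = v i" if "i \<in> {1..k}" for i
      using that by (metis atLeastLessThan_iff mod_eq_dvd_iff mod_pos_pos_trivial)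
    then show "u = v" using uv unfolding B_def by (intro PiE_ext) auto
  qed
  then have "\<Phi> ` B = B" using endo_inj_surj[OF finB sub] by simp
  moreover have "(\<lambda>j\<in>{1..k}. w j mod p ^ M) \<in> B" using pM by (auto simp: B_def)
  ultimately obtain v where v: "\<Phi> v = (\<lambda>j\<in>{1..k}. w j mod p ^ M)" by (metis imageE)
  have "p ^ M dvd (\<Sum>i=1..k. v i * A i j) - w j" if "j \<in> {1..k}" for j
    using fun_cong[OF v, of j] that by (simp add: \<Phi>_def mod_eq_dvd_iff)
  then show ?thesis by blast
qed

text \<open>Hermite interpolation modulo p^M: a combination of the components can have
  \<open>k - l\<close> prescribed Taylor coefficients at \<open>t1\<close> and \<open>l\<close> at
  \<open>t0\<close>. The data chosen are flatness at \<open>t1\<close> and the jet of the i-th power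
  around \<open>t0\<close>. Constant coefficients are left free, since they only produce factors of
  modulus 1.\<close>

lemma curve_jet_matrix:
  assumes p: "prime p" and k: "int k < p" and \<gamma>: "curve p k \<gamma>" and l: "l \<le> k"
    and t: "\<not> p dvd t0 - t1" and i: "i \<in> {1..l}"
  shows "\<exists>X H. H = (\<Sum>j=1..k. smult (X j) (\<gamma> j)) \<and>
    (\<forall>j\<in>{1..k-l}. p ^ M dvd coeff (pcompose H [:t1, 1:]) j) \<and>
    (\<forall>j\<in>{1..l}. p ^ M dvd coeff (pcompose H [:t0, 1:]) j - (if j = i then 1 else 0))"
proof -
  \<comment> \<open>Columns up to \<open>k - l\<close> record the jet at \<open>t1\<close>; the
    other \<open>l\<close>, shifted by \<open>k - l\<close>, record the jet at
    \<open>t0\<close>.\<close>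
  define A where "A = (\<lambda>i j. if j \<le> k - l then coeff (pcompose (\<gamma> i) [:t1, 1:]) j
                         else coeff (pcompose (\<gamma> i) [:t0, 1:]) (j - (k - l)))"
  define H where "H = (\<lambda>v. \<Sum>i=1..k. smult (v i) (\<gamma> i))"
  have co: "coeff (pcompose (H v) q) j = (\<Sum>i=1..k. v i * coeff (pcompose (\<gamma> i) q) j)" for v q j
    by (simp add: H_def pcompose_sum pcompose_smult coeff_sum)
  have A1: "(\<Sum>i=1..k. v i * A i j) = coeff (pcompose (H v) [:t1, 1:]) j" if "j \<in> {1..k-l}" for v j
    using that by (simp add: co A_def)
  have A0: "(\<Sum>i=1..k. v i * A i (j + (k - l))) = coeff (pcompose (H v) [:t0, 1:]) j" if "j \<in> {1..l}" for v j
    using that by (simp add: co A_def)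
  have inj: "p dvd v i" if dv: "\<And>j. j \<in> {1..k} \<Longrightarrow> p dvd (\<Sum>i=1..k. v i * A i j)" and i: "i \<in> {1..k}" for v i
  proof (rule poly_jets_zero_mod[OF p k l t refl _ _ i])
    let ?H = "\<Sum>i=1..k. monom (v i) i"
    have "H v - ?H = (\<Sum>i=1..k. smult (v i) (\<gamma> i - monom 1 i))"
      by (simp add: H_def sum_subtractf smult_diff_right smult_monom)
    also have "[:p:] dvd \<dots>" using \<gamma> by (intro dvd_sum dvd_smult) (auto simp: curve_def)
    finally have d: "[:p:] dvd H v - ?H" .
    have cong: "p dvd coeff (pcompose ?H q) j" if "p dvd coeff (pcompose (H v) q) j" for q j
    proof -
      have "p dvd coeff (pcompose (H v) q - pcompose ?H q) j"
        using dvd_pcompose[OF d, of q] unfolding const_poly_dvd_iff pcompose_diff by blast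
      from dvd_diff[OF that this] show ?thesis by simp
    qed
    show "p dvd coeff (pcompose ?H [:t1, 1:]) j" if "j \<in> {1..k-l}" for j
    proof (rule cong)
      have "j \<in> {1..k}" using that by auto
      from dv[OF this] show "p dvd coeff (pcompose (H v) [:t1, 1:]) j" unfolding A1[OF that] .
    qed
    show "p dvd coeff (pcompose ?H [:t0, 1:]) j" if "j \<in> {1..l}" for j
    proof (rule cong)
      have "j + (k - l) \<in> {1..k}" using that l by auto
      from dv[OF this] show "p dvd coeff (pcompose (H v) [:t0, 1:]) j" unfolding A0[OF that] .
    qed
  qed
  have "p > 1" using p by (simp add: prime_gt_1_int)
  then have "\<exists>v. \<forall>j\<in>{1..k}. p ^ M dvd (\<Sum>i=1..k. v i * A i j) - (if j = i + (k - l) then 1 else 0)"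
    by (rule unimodular_mod_prime_power) (rule inj)
  then obtain X where X: "\<And>j. j \<in> {1..k} \<Longrightarrow>
      p ^ M dvd (\<Sum>i=1..k. X i * A i j) - (if j = i + (k - l) then 1 else 0)" by blast
  show ?thesis
  proof (intro exI[of _ X] exI[of _ "H X"] conjI ballI)
    show "p ^ M dvd coeff (pcompose (H X) [:t1, 1:]) j" if "j \<in> {1..k-l}" for j
    proof -
      have "j \<in> {1..k}" "j \<noteq> i + (k - l)" using that i by auto
      with X[of j] show ?thesis unfolding A1[OF that] by simp
    qed
    show "p ^ M dvd coeff (pcompose (H X) [:t0, 1:]) j - (if j = i then 1 else 0)" if "j \<in> {1..l}" for j
    proof -
      have "j + (k - l) \<in> {1..k}" using that l by auto
      from X[OF this] show ?thesis unfolding A0[OF that] by simp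
    qed
  qed (simp add: H_def)
qed

lemma poly_sum_bound: "poly q x = (\<Sum>j\<le>degree q + n. coeff q j * x ^ j)" for x :: "'a::comm_ring_1"
  unfolding poly_altdef by (intro sum.mono_neutral_left) (auto simp: coeff_eq_0)

text \<open>The interpolating combinations serve as \<open>l\<close> new coordinates. On t0 + p^a s
  the terms of degree j > l carry p^(a j), which after removal of p^(a i) is still a positive power
  of \<open>p\<close>, so \<open>\<eta>\<close> is again a nondegenerate curve. On t1 + p^b y the
  degrees from 1 to k - l vanish modulo p^M, and all higher ones are divisible by p^(b (k - l +
  1)).\<close>

lemma curve_local:
  fixes \<gamma> :: "nat \<Rightarrow> int poly"
  assumes p: "prime p" and k: "int k < p" and \<gamma>: "curve p k \<gamma>" and l: "l \<le> k"
    and t: "\<not> p dvd t0 - t1" and a: "a \<ge> 1" and M: "b * (k - l + 1) \<le> M"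
  shows "\<exists>X \<eta> c c'. curve p l \<eta> \<and>
    (\<forall>i\<in>{1..l}. \<forall>s. p ^ M dvd (\<Sum>j=1..k. X i j * poly (\<gamma> j) (t0 + p ^ a * s)) - (c i + p ^ (a * i) * poly (\<eta> i) s)) \<and>
    (\<forall>i\<in>{1..l}. \<forall>y. p ^ (b * (k - l + 1)) dvd (\<Sum>j=1..k. X i j * poly (\<gamma> j) (t1 + p ^ b * y)) - c' i)"
proof -
  have "\<forall>i\<in>{1..l}. \<exists>X H. H = (\<Sum>j=1..k. smult (X j) (\<gamma> j)) \<and>
    (\<forall>j\<in>{1..k-l}. p ^ M dvd coeff (pcompose H [:t1, 1:]) j) \<and>
    (\<forall>j\<in>{1..l}. p ^ M dvd coeff (pcompose H [:t0, 1:]) j - (if j = i then 1 else 0))"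
    using curve_jet_matrix[OF p k \<gamma> l t] by blast
  from bchoice[OF this] obtain X where X: "\<And>i. i \<in> {1..l} \<Longrightarrow> \<exists>H. H = (\<Sum>j=1..k. smult (X i j) (\<gamma> j)) \<and>
    (\<forall>j\<in>{1..k-l}. p ^ M dvd coeff (pcompose H [:t1, 1:]) j) \<and>
    (\<forall>j\<in>{1..l}. p ^ M dvd coeff (pcompose H [:t0, 1:]) j - (if j = i then 1 else 0))" by blast
  define H where "H = (\<lambda>i. \<Sum>j=1..k. smult (X i j) (\<gamma> j))"
  have H1: "p ^ M dvd coeff (pcompose (H i) [:t1, 1:]) j" if "i \<in> {1..l}" "j \<in> {1..k-l}" for i j
    using X[OF that(1)] that(2) unfolding H_def by blast
  have H0: "p ^ M dvd coeff (pcompose (H i) [:t0, 1:]) j - (if j = i then 1 else 0)"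
    if "i \<in> {1..l}" "j \<in> {1..l}" for i j
    using X[OF that(1)] that(2) unfolding H_def by blast
  define B where "B = (\<lambda>i. pcompose (H i) [:t0, 1:])"
  define C where "C = (\<lambda>i. pcompose (H i) [:t1, 1:])"
  \<comment> \<open>Adding \<open>l\<close> keeps all degrees up to \<open>l\<close> in the range
    even if \<open>B i\<close> has smaller degree; the extra coefficients are 0.\<close>
  define n where "n = (\<lambda>i. degree (B i) + l)"
  define \<eta> where "\<eta> = (\<lambda>i. monom 1 i + (\<Sum>j\<in>{l+1..n i}. monom (coeff (B i) j * p ^ (a * (j - i))) j))"
  have polyH: "poly (H i) z = (\<Sum>j=1..k. X i j * poly (\<gamma> j) z)" for i z
    by (simp add: H_def poly_sum)
  have "curve p l \<eta>"
    unfolding curve_def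
  proof
    fix i assume i: "i \<in> {1..l}"
    have "[:p:] dvd monom (coeff (B i) j * p ^ (a * (j - i))) j" if "j \<in> {l+1..n i}" for j
    proof -
      have "a * (j - i) \<ge> 1" using a i that by auto
      then have "p dvd p ^ (a * (j - i))" by (intro dvd_power) auto
      then show ?thesis by (auto simp: const_poly_dvd_iff)
    qed
    then show "[:p:] dvd \<eta> i - monom 1 i" unfolding \<eta>_def by (auto intro: dvd_sum)
  qed
  moreover have "p ^ M dvd (\<Sum>j=1..k. X i j * poly (\<gamma> j) (t0 + p ^ a * s)) - (coeff (B i) 0 + p ^ (a * i) * poly (\<eta> i) s)"
    if i: "i \<in> {1..l}" for i s
  proof -
    have "(\<Sum>j=1..k. X i j * poly (\<gamma> j) (t0 + p ^ a * s)) = poly (B i) (p ^ a * s)"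
      unfolding polyH[symmetric] by (simp add: B_def poly_pcompose)
    also have "\<dots> = (\<Sum>j\<le>n i. coeff (B i) j * (p ^ a * s) ^ j)"
      unfolding n_def by (rule poly_sum_bound)
    also have "{..n i} = insert 0 ({1..l} \<union> {l+1..n i})" by (auto simp: n_def)
    also have "(\<Sum>j\<in>\<dots>. coeff (B i) j * (p ^ a * s) ^ j) =
       coeff (B i) 0 + ((\<Sum>j\<in>{1..l}. coeff (B i) j * (p ^ a * s) ^ j) + (\<Sum>j\<in>{l+1..n i}. coeff (B i) j * (p ^ a * s) ^ j))"
      by (subst sum.insert, simp, simp, subst sum.union_disjoint) auto
    also have "(\<Sum>j\<in>{l+1..n i}. coeff (B i) j * (p ^ a * s) ^ j) = p ^ (a * i) * (poly (\<eta> i) s - s ^ i)"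
      unfolding \<eta>_def poly_add poly_sum poly_monom add_diff_cancel_left' sum_distrib_left mult_1
    proof (intro sum.cong refl)
      fix j assume "j \<in> {l+1..n i}"
      then have "a * j = a * i + a * (j - i)" using i by (simp add: algebra_simps)
      then have "p ^ (a * j) = p ^ (a * i) * p ^ (a * (j - i))" by (simp add: power_add)
      then show "coeff (B i) j * (p ^ a * s) ^ j = p ^ (a * i) * (coeff (B i) j * p ^ (a * (j - i)) * s ^ j)"
        by (simp add: power_mult_distrib power_mult[symmetric] mult_ac)
    qed
    finally have "(\<Sum>j=1..k. X i j * poly (\<gamma> j) (t0 + p ^ a * s)) - (coeff (B i) 0 + p ^ (a * i) * poly (\<eta> i) s)
       = (\<Sum>j\<in>{1..l}. coeff (B i) j * (p ^ a * s) ^ j) - p ^ (a * i) * s ^ i"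
      by (simp add: algebra_simps)
    also have "p ^ (a * i) * s ^ i = (\<Sum>j\<in>{1..l}. (if j = i then 1 else 0) * (p ^ a * s) ^ j)"
      using i by (simp add: if_distrib[of "\<lambda>x. x * _"] power_mult_distrib power_mult cong: if_cong)
    also have "(\<Sum>j\<in>{1..l}. coeff (B i) j * (p ^ a * s) ^ j) - \<dots> =
        (\<Sum>j\<in>{1..l}. (coeff (B i) j - (if j = i then 1 else 0)) * (p ^ a * s) ^ j)"
      by (simp add: sum_subtractf left_diff_distrib)
    also have "p ^ M dvd \<dots>" using H0[OF i] unfolding B_def by (intro dvd_sum dvd_mult2) auto
    finally show ?thesis .
  qed
  moreover have "p ^ (b * (k - l + 1)) dvd (\<Sum>j=1..k. X i j * poly (\<gamma> j) (t1 + p ^ b * y)) - coeff (C i) 0"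
    if i: "i \<in> {1..l}" for i y
  proof -
    have "(\<Sum>j=1..k. X i j * poly (\<gamma> j) (t1 + p ^ b * y)) = poly (C i) (p ^ b * y)"
      unfolding polyH[symmetric] by (simp add: C_def poly_pcompose)
    also have "\<dots> = (\<Sum>j\<le>degree (C i). coeff (C i) j * (p ^ b * y) ^ j)" by (rule poly_altdef)
    also have "\<dots> = coeff (C i) 0 + (\<Sum>j\<in>{..degree (C i)} - {0}. coeff (C i) j * (p ^ b * y) ^ j)"
      by (subst sum.remove[of _ 0]) auto
    finally have "(\<Sum>j=1..k. X i j * poly (\<gamma> j) (t1 + p ^ b * y)) - coeff (C i) 0
       = (\<Sum>j\<in>{..degree (C i)} - {0}. coeff (C i) j * (p ^ b * y) ^ j)" by simp
    also have "p ^ (b * (k - l + 1)) dvd \<dots>"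
    proof (rule dvd_sum)
      fix j assume j: "j \<in> {..degree (C i)} - {0}"
      show "p ^ (b * (k - l + 1)) dvd coeff (C i) j * (p ^ b * y) ^ j"
      proof (cases "j \<le> k - l")
        case True
        then have "p ^ M dvd coeff (C i) j" using H1[OF i, of j] j by (simp add: C_def)
        then show ?thesis using M by (meson dvd_mult2 dvd_trans le_imp_power_dvd)
      next
        case False
        then have "b * (k - l + 1) \<le> b * j" by (intro mult_left_mono) auto
        then have "p ^ (b * (k - l + 1)) dvd p ^ (b * j)" by (rule le_imp_power_dvd)
        then show ?thesis by (simp add: power_mult_distrib power_mult[symmetric])
      qed
    qed
    finally show ?thesis .
  qed
  ultimately show ?thesis
    by - (rule exI[of _ X], rule exI[of _ \<eta>], rule exI[of _ "\<lambda>i. coeff (B i) 0"],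
        rule exI[of _ "\<lambda>i. coeff (C i) 0"], blast)
qed

text \<open>The vectors \<open>h\<close> are the translations in phase space that leave the modulus of the exponential
  sum over \<open>t1 + p ^ b * \<int>\<close> unchanged and act on the one over \<open>t0 + p ^ a * \<int>\<close> through an
  \<open>l\<close>-dimensional curve \<open>\<eta>\<close>.\<close>

lemma curve_local_phase:
  fixes \<gamma> :: "nat \<Rightarrow> int poly"
  assumes p: "prime p" and k: "int k < p" and \<gamma>: "curve p k \<gamma>" and l: "l \<le> k"
    and t: "\<not> p dvd t0 - t1" and a: "1 \<le> a" "a \<le> c" and c: "c \<le> m" "l * c \<le> b * (k - l + 1)"
  shows "\<exists>\<eta>. curve p l \<eta> \<and> (\<forall>u. \<exists>h C C'.
     (\<forall>s. p ^ (k * m) dvd (\<Sum>j=1..k. h j * poly (\<gamma> j) (t0 + p ^ a * s))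
            - (C + p ^ (k * m - l * (c - a)) * (\<Sum>i=1..l. u i * poly (\<eta> i) s))) \<and>
     (\<forall>y. p ^ (k * m) dvd (\<Sum>j=1..k. h j * poly (\<gamma> j) (t1 + p ^ b * y)) - C'))"
proof -
  \<comment> \<open>Large enough for the errors of \<open>curve_local\<close> to vanish modulo p^(k
    m) and for its lower bound on \<open>M\<close>.\<close>
  define M where "M = k * m + b * (k - l + 1)"
  have "b * (k - l + 1) \<le> M" by (simp add: M_def)
  from curve_local[OF p k \<gamma> l t a(1) this] obtain X \<eta> c0 c1 where \<eta>: "curve p l \<eta>"
    and h0: "\<And>i s. i \<in> {1..l} \<Longrightarrow> p ^ M dvd (\<Sum>j=1..k. X i j * poly (\<gamma> j) (t0 + p ^ a * s)) - (c0 i + p ^ (a * i) * poly (\<eta> i) s)"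
    and h1: "\<And>i y. i \<in> {1..l} \<Longrightarrow> p ^ (b * (k - l + 1)) dvd (\<Sum>j=1..k. X i j * poly (\<gamma> j) (t1 + p ^ b * y)) - c1 i"
    by blast
  have lc: "l * c \<le> k * m" using l c by (intro mult_mono) auto
  \<comment> \<open>The multiplier p^(E i) equalizes the scales p^(a i) of the new coordinates:
    \<open>E i + a * i\<close> does not depend on \<open>i\<close>. Moreover
    \<open>E i \<ge> k * m - l * c\<close>, which with \<open>l * c \<le> b * (k - l + 1)\<close>
    makes the phase constant on the class of \<open>t1\<close>.\<close>
  define E where "E = (\<lambda>i. k * m - l * c + (l - i) * a)"
  have E: "E i + a * i = k * m - l * (c - a)" if "i \<in> {1..l}" for i
  proof -
    have "(l - i) * a + a * i = l * a" using that by (simp add: algebra_simps)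
    moreover have "l * (c - a) + l * a = l * c" using a by (simp flip: distrib_left)
    moreover have "k * m - l * c + l * c = k * m" using lc by simp
    ultimately show ?thesis unfolding E_def by linarith
  qed
  show ?thesis
  proof (intro exI[of _ \<eta>] conjI \<eta> allI)
    fix u :: "nat \<Rightarrow> int"
    define h where "h = (\<lambda>j. \<Sum>i=1..l. u i * p ^ E i * X i j)"
    have hsum: "(\<Sum>j=1..k. h j * z j) = (\<Sum>i=1..l. u i * p ^ E i * (\<Sum>j=1..k. X i j * z j))" for z
      unfolding h_def sum_distrib_left sum_distrib_right
      by (subst sum.swap) (simp add: mult_ac)
    show "\<exists>h C C'.
     (\<forall>s. p ^ (k * m) dvd (\<Sum>j=1..k. h j * poly (\<gamma> j) (t0 + p ^ a * s))
            - (C + p ^ (k * m - l * (c - a)) * (\<Sum>i=1..l. u i * poly (\<eta> i) s))) \<and>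
     (\<forall>y. p ^ (k * m) dvd (\<Sum>j=1..k. h j * poly (\<gamma> j) (t1 + p ^ b * y)) - C')"
    proof (rule exI[of _ h], rule exI[of _ "\<Sum>i=1..l. u i * p ^ E i * c0 i"],
        rule exI[of _ "\<Sum>i=1..l. u i * p ^ E i * c1 i"], intro conjI allI)
      fix s
      have "p ^ (k * m - l * (c - a)) * (\<Sum>i=1..l. u i * poly (\<eta> i) s) =
          (\<Sum>i=1..l. u i * p ^ E i * (p ^ (a * i) * poly (\<eta> i) s))"
        unfolding sum_distrib_left by (intro sum.cong refl) (simp add: E[symmetric] power_add mult_ac)
      then have "(\<Sum>j=1..k. h j * poly (\<gamma> j) (t0 + p ^ a * s))
            - ((\<Sum>i=1..l. u i * p ^ E i * c0 i) + p ^ (k * m - l * (c - a)) * (\<Sum>i=1..l. u i * poly (\<eta> i) s))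
          = (\<Sum>i=1..l. u i * p ^ E i * ((\<Sum>j=1..k. X i j * poly (\<gamma> j) (t0 + p ^ a * s)) - (c0 i + p ^ (a * i) * poly (\<eta> i) s)))"
        unfolding hsum by (simp add: right_diff_distrib distrib_left sum_subtractf sum.distrib)
      also have "p ^ M dvd \<dots>" by (intro dvd_sum dvd_mult h0) auto
      finally show "p ^ (k * m) dvd (\<Sum>j=1..k. h j * poly (\<gamma> j) (t0 + p ^ a * s))
            - ((\<Sum>i=1..l. u i * p ^ E i * c0 i) + p ^ (k * m - l * (c - a)) * (\<Sum>i=1..l. u i * poly (\<eta> i) s))"
        by (rule power_le_dvd) (simp add: M_def)
    next
      fix y
      have "(\<Sum>j=1..k. h j * poly (\<gamma> j) (t1 + p ^ b * y)) - (\<Sum>i=1..l. u i * p ^ E i * c1 i)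
          = (\<Sum>i=1..l. u i * (p ^ E i * ((\<Sum>j=1..k. X i j * poly (\<gamma> j) (t1 + p ^ b * y)) - c1 i)))"
        unfolding hsum by (simp add: right_diff_distrib sum_subtractf mult.assoc)
      also have "p ^ (k * m) dvd \<dots>"
      proof (rule dvd_sum, rule dvd_mult)
        fix i assume i: "i \<in> {1..l}"
        have "k * m \<le> E i + b * (k - l + 1)" using lc c(2) unfolding E_def by linarith
        then have "p ^ (k * m) dvd p ^ E i * p ^ (b * (k - l + 1))"
          unfolding power_add[symmetric] by (rule le_imp_power_dvd)
        also have "\<dots> dvd p ^ E i * ((\<Sum>j=1..k. X i j * poly (\<gamma> j) (t1 + p ^ b * y)) - c1 i)"
          by (intro mult_dvd_mono h1 i dvd_refl)
        finally show "p ^ (k * m) dvd p ^ E i * ((\<Sum>j=1..k. X i j * poly (\<gamma> j) (t1 + p ^ b * y)) - c1 i)" .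
      qed
      finally show "p ^ (k * m) dvd (\<Sum>j=1..k. h j * poly (\<gamma> j) (t1 + p ^ b * y)) - (\<Sum>i=1..l. u i * p ^ E i * c1 i)" .
    qed
  qed
qed

section \<open>Exponential sums and decoupling constants\<close>

definition add_char :: "int \<Rightarrow> int \<Rightarrow> complex" where
  "add_char Q z = cis (2 * pi * real_of_int z / real_of_int Q)"

lemma norm_add_char [simp]: "cmod (add_char Q z) = 1"
  by (simp add: add_char_def)

lemma add_char_add: "add_char Q (a + b) = add_char Q a * add_char Q b"
  by (simp add: add_char_def cis_mult add_divide_distrib ring_distribs)

lemma add_char_cong:
  assumes "Q dvd a - b"
  shows "add_char Q a = add_char Q b"
proof -
  from assms obtain c where "a = b + Q * c" by (metis dvdE diff_add_cancel add.commute)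
  moreover have "add_char Q (Q * c) = 1"
  proof (cases "Q = 0")
    case False
    have "add_char Q (Q * c) = cis (2 * pi * real_of_int c)" using False by (simp add: add_char_def mult.assoc)
    then show ?thesis using cis_multiple_2pi[of "real_of_int c"] by simp
  qed (simp add: add_char_def)
  ultimately show ?thesis by (simp add: add_char_add)
qed

lemma add_char_cancel: "d \<noteq> 0 \<Longrightarrow> add_char (d * Q) (d * z) = add_char Q z"
  by (simp add: add_char_def mult.left_commute[of _ "real_of_int d"])

section \<open>Mean values over a finite torus\<close>

definition torus :: "nat \<Rightarrow> int \<Rightarrow> (nat \<Rightarrow> int) set" where
  "torus k Q = {1..k} \<rightarrow>\<^sub>E {0..<Q}"

text \<open>\<open>x j / Q\<close> runs over the multiples of \<open>1 / Q\<close> instead of the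
  whole circle. Integrals become finite sums, and orthogonality detects congruences modulo
  \<open>Q\<close> instead of equations.\<close>

definition avg :: "nat \<Rightarrow> int \<Rightarrow> ((nat \<Rightarrow> int) \<Rightarrow> real) \<Rightarrow> real" where
  "avg k Q F = (\<Sum>x\<in>torus k Q. F x) / real_of_int Q ^ k"

lemma finite_torus [simp]: "finite (torus k Q)"
  unfolding torus_def by (intro finite_PiE) auto

lemma card_torus: "Q \<ge> 0 \<Longrightarrow> real (card (torus k Q)) = real_of_int Q ^ k"
  by (simp add: torus_def card_PiE)

lemma avg_mono: "Q > 0 \<Longrightarrow> (\<And>x. F x \<le> G x) \<Longrightarrow> avg k Q F \<le> avg k Q G"
  unfolding avg_def by (intro divide_right_mono sum_mono) auto

lemma avg_nonneg: "Q > 0 \<Longrightarrow> (\<And>x. F x \<ge> 0) \<Longrightarrow> avg k Q F \<ge> 0"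
  unfolding avg_def by (intro divide_nonneg_pos sum_nonneg) auto

lemma avg_cmult: "avg k Q (\<lambda>x. c * F x) = c * avg k Q F"
  by (simp add: avg_def sum_distrib_left)

lemma avg_const: "Q > 0 \<Longrightarrow> avg k Q (\<lambda>x. c) = c"
  by (simp add: avg_def card_torus)

lemma avg_swap: "avg k Q (\<lambda>x. avg l R (F x)) = avg l R (\<lambda>u. avg k Q (\<lambda>x. F x u))"
  unfolding avg_def sum_divide_distrib by (subst sum.swap) (simp add: field_simps)

lemma avg_minkowski:
  assumes Q: "Q > 0" and fin: "finite T" and r: "r \<ge> 1" and w: "\<And>x. w x \<ge> 0"
    and F: "\<And>t x. t \<in> T \<Longrightarrow> F t x \<ge> 0" and e: "\<And>t. t \<in> T \<Longrightarrow> e t \<ge> 0"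
    and le: "\<And>t. t \<in> T \<Longrightarrow> avg k Q (\<lambda>x. w x * F t x ^ r) \<le> e t ^ r"
  shows "avg k Q (\<lambda>x. w x * (\<Sum>t\<in>T. F t x) ^ r) \<le> (\<Sum>t\<in>T. e t) ^ r"
proof -
  have *: "avg k Q (\<lambda>x. w x * G x) = (\<Sum>x\<in>torus k Q. w x / real_of_int Q ^ k * G x)" for G
    by (simp add: avg_def sum_divide_distrib)
  show ?thesis unfolding *
  proof (rule minkowski_power[OF fin r])
    show "0 \<le> w x / real_of_int Q ^ k" for x using w[of x] Q by simp
  qed (use F e le in \<open>auto simp: *\<close>)
qed

lemma avg_holder:
  assumes Q: "Q > 0" and "\<And>x. X x \<ge> 0" "\<And>x. Y x \<ge> 0" "\<And>x. Z x \<ge> 0"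
    and ij: "i \<ge> 1" "j \<ge> 1" and eq: "\<And>x. Z x ^ (i + j) = X x ^ i * Y x ^ j"
  shows "avg k Q Z ^ (i + j) \<le> avg k Q X ^ i * avg k Q Y ^ j"
proof -
  have "(\<Sum>x\<in>torus k Q. Z x) ^ (i + j) \<le> (\<Sum>x\<in>torus k Q. X x) ^ i * (\<Sum>x\<in>torus k Q. Y x) ^ j"
    by (rule holder_power) (use assms in auto)
  then have "(\<Sum>x\<in>torus k Q. Z x) ^ (i + j) / (real_of_int Q ^ k) ^ (i + j)
      \<le> (\<Sum>x\<in>torus k Q. X x) ^ i * (\<Sum>x\<in>torus k Q. Y x) ^ j / (real_of_int Q ^ k) ^ (i + j)"
    using Q by (intro divide_right_mono) auto
  then show ?thesis by (simp add: avg_def power_divide power_add)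
qed

definition torus_periodic :: "nat \<Rightarrow> int \<Rightarrow> ((nat \<Rightarrow> int) \<Rightarrow> 'a) \<Rightarrow> bool" where
  "torus_periodic k Q F \<longleftrightarrow> (\<forall>x y. (\<forall>i\<in>{1..k}. Q dvd x i - y i) \<longrightarrow> F x = F y)"

lemma avg_shift:
  assumes Q: "Q > 0" and F: "torus_periodic k Q F"
  shows "avg k Q (\<lambda>x. F (\<lambda>i. x i + h i)) = avg k Q F"
proof -
  define S where "S = (\<lambda>x. \<lambda>i\<in>{1..k}. (x i + h i) mod Q)"
  have sub: "S ` torus k Q \<subseteq> torus k Q" using Q by (auto simp: S_def torus_def)
  have inj: "inj_on S (torus k Q)"
  proof (rule inj_onI)
    fix x y assume xy: "x \<in> torus k Q" "y \<in> torus k Q" "S x = S y"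
    have "x i = y i" if i: "i \<in> {1..k}" for i
    proof -
      have "(x i + h i) mod Q = (y i + h i) mod Q" using fun_cong[OF xy(3), of i] i by (simp add: S_def)
      then have "x i mod Q = y i mod Q" by (simp add: mod_eq_dvd_iff)
      moreover have "x i \<in> {0..<Q}" "y i \<in> {0..<Q}" using xy i by (auto simp: torus_def)
      ultimately show ?thesis by simp
    qed
    then show "x = y" using xy unfolding torus_def by (intro PiE_ext) auto
  qed
  have img: "S ` torus k Q = torus k Q" by (rule endo_inj_surj[OF finite_torus sub inj])
  have "F (\<lambda>i. x i + h i) = F (S x)" for x
  proof -
    have "\<forall>i\<in>{1..k}. Q dvd (x i + h i) - S x i" by (simp add: S_def dvd_minus_mod)
    then show ?thesis
      using F[unfolded torus_periodic_def, THEN spec[of _ "\<lambda>i. x i + h i"], THEN spec[of _ "S x"]] by simp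
  qed
  then have "(\<Sum>x\<in>torus k Q. F (\<lambda>i. x i + h i)) = (\<Sum>x\<in>torus k Q. F (S x))" by simp
  also have "\<dots> = (\<Sum>x\<in>S ` torus k Q. F x)" by (simp add: sum.reindex[OF inj])
  finally show ?thesis by (simp add: avg_def img)
qed

definition expsum :: "nat \<Rightarrow> int \<Rightarrow> (nat \<Rightarrow> int poly) \<Rightarrow> (int \<Rightarrow> complex) \<Rightarrow> int set \<Rightarrow> (nat \<Rightarrow> int) \<Rightarrow> complex" where
  "expsum k Q \<gamma> \<alpha> N x = (\<Sum>n\<in>N. \<alpha> n * add_char Q (\<Sum>j=1..k. x j * poly (\<gamma> j) n))"

text \<open>The squared modulus turns the exponent 2 r into the power \<open>r\<close>. In terms of
  it, a decoupling bound of type l^2 has the shape of a triangle inequality in L^r, which is why it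
  combines with \<open>avg_minkowski\<close>.\<close>

definition energy :: "nat \<Rightarrow> int \<Rightarrow> (nat \<Rightarrow> int poly) \<Rightarrow> (int \<Rightarrow> complex) \<Rightarrow> int set \<Rightarrow> (nat \<Rightarrow> int) \<Rightarrow> real" where
  "energy k Q \<gamma> \<alpha> N x = (cmod (expsum k Q \<gamma> \<alpha> N x))\<^sup>2"

definition cls :: "int \<Rightarrow> nat \<Rightarrow> int \<Rightarrow> int set \<Rightarrow> int set" where
  "cls p a t N = {n \<in> N. p ^ a dvd n - t}"

lemma energy_nonneg [simp]: "energy k Q \<gamma> \<alpha> N x \<ge> 0"
  by (simp add: energy_def)

lemma finite_cls [simp]: "finite N \<Longrightarrow> finite (cls p a t N)"
  by (simp add: cls_def)

lemma energy_periodic: "torus_periodic k Q (energy k Q \<gamma> \<alpha> N)"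
  unfolding torus_periodic_def
proof (intro allI impI)
  fix x y assume xy: "\<forall>i\<in>{1..k}. Q dvd x i - y i"
  have "add_char Q (\<Sum>j=1..k. x j * poly (\<gamma> j) n) = add_char Q (\<Sum>j=1..k. y j * poly (\<gamma> j) n)" for n
  proof (rule add_char_cong)
    have "(\<Sum>j=1..k. x j * poly (\<gamma> j) n) - (\<Sum>j=1..k. y j * poly (\<gamma> j) n) =
       (\<Sum>j=1..k. (x j - y j) * poly (\<gamma> j) n)" by (simp add: sum_subtractf left_diff_distrib)
    also have "Q dvd \<dots>" using xy by (intro dvd_sum dvd_mult2) auto
    finally show "Q dvd (\<Sum>j=1..k. x j * poly (\<gamma> j) n) - (\<Sum>j=1..k. y j * poly (\<gamma> j) n)" .
  qed
  then show "energy k Q \<gamma> \<alpha> N x = energy k Q \<gamma> \<alpha> N y" by (simp add: energy_def expsum_def)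
qed

definition crit :: "nat \<Rightarrow> nat" where "crit k = k * (k + 1) div 2"

text \<open>\<open>d \<rho>\<close> stands for the squared \<open>L\<close>-norm of exponent \<open>2 * crit k\<close> of the sum over the
  class of \<open>\<rho>\<close>, so that \<open>K\<close> is the \<open>\<ell>\<^sup>2\<close> decoupling constant, raised to that exponent, at scale
  \<open>p ^ m\<close>. Bounding the norms by \<open>d\<close> avoids taking roots.\<close>

definition dec :: "int \<Rightarrow> nat \<Rightarrow> nat \<Rightarrow> real \<Rightarrow> bool" where
  "dec p k m K \<longleftrightarrow> (\<forall>\<gamma> N \<alpha> d. curve p k \<gamma> \<longrightarrow> finite N \<longrightarrow>
     (\<forall>\<rho>\<in>{0..<p^m}. d \<rho> \<ge> 0 \<and>
        avg k (p ^ (k * m)) (\<lambda>x. energy k (p ^ (k * m)) \<gamma> \<alpha> (cls p m \<rho> N) x ^ crit k) \<le> d \<rho> ^ crit k) \<longrightarrow>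
     avg k (p ^ (k * m)) (\<lambda>x. energy k (p ^ (k * m)) \<gamma> \<alpha> N x ^ crit k) \<le> K * (\<Sum>\<rho>\<in>{0..<p^m}. d \<rho>) ^ crit k)"

text \<open>Translation by \<open>h\<close> multiplies each term by a phase that is, up to a
  constant, \<open>D\<close> times a combination of the \<open>\<eta> i\<close>. Cancelling
  \<open>D\<close> lowers the modulus to \<open>R\<close>, and the untranslated phase is absorbed
  into the coefficients.\<close>

lemma expsum_twist:
  assumes S: "N = (\<lambda>s. t0 + g * s) ` S" and g: "g \<noteq> 0" and D: "D \<noteq> 0"
    and h: "\<And>s. D * R dvd (\<Sum>j=1..k. h j * poly (\<gamma> j) (t0 + g * s)) - (C + D * (\<Sum>i=1..l. u i * poly (\<eta> i) s))"
  shows "expsum k (D * R) \<gamma> \<alpha> N (\<lambda>i. x i + h i) = add_char (D * R) C *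
     expsum l R \<eta> (\<lambda>s. \<alpha> (t0 + g * s) * add_char (D * R) (\<Sum>j=1..k. x j * poly (\<gamma> j) (t0 + g * s))) S u"
proof -
  have inj: "inj_on (\<lambda>s. t0 + g * s) S" using g by (auto simp: inj_on_def)
  have "add_char (D * R) (\<Sum>j=1..k. (x j + h j) * poly (\<gamma> j) (t0 + g * s)) =
     add_char (D * R) (\<Sum>j=1..k. x j * poly (\<gamma> j) (t0 + g * s)) * (add_char (D * R) C * add_char R (\<Sum>i=1..l. u i * poly (\<eta> i) s))" for s
  proof -
    have "(\<Sum>j=1..k. (x j + h j) * poly (\<gamma> j) (t0 + g * s)) =
      (\<Sum>j=1..k. x j * poly (\<gamma> j) (t0 + g * s)) + (\<Sum>j=1..k. h j * poly (\<gamma> j) (t0 + g * s))"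
      by (simp add: distrib_right sum.distrib)
    then show ?thesis
      by (simp only: add_char_add add_char_cong[OF h[of s]] add_char_cancel[OF D])
  qed
  then show ?thesis
    unfolding expsum_def S sum.reindex[OF inj] o_def sum_distrib_left by (simp add: mult_ac)
qed

lemma cls_affine:
  assumes p: "p \<noteq> (0::int)" and "a \<le> c"
  shows "cls p c (t0 + p ^ a * \<sigma>) N = (\<lambda>s. t0 + p ^ a * s) ` cls p (c - a) \<sigma> {s. t0 + p ^ a * s \<in> N}"
proof -
  have pc: "p ^ c = p ^ a * p ^ (c - a)" using assms by (simp flip: power_add)
  have *: "p ^ c dvd (t0 + p ^ a * s) - (t0 + p ^ a * \<sigma>) \<longleftrightarrow> p ^ (c - a) dvd s - \<sigma>" for s
  proof -
    have "(t0 + p ^ a * s) - (t0 + p ^ a * \<sigma>) = p ^ a * (s - \<sigma>)" by (simp add: algebra_simps)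
    then show ?thesis using p by (simp add: pc)
  qed
  have "n \<in> (\<lambda>s. t0 + p ^ a * s) ` cls p (c - a) \<sigma> {s. t0 + p ^ a * s \<in> N}"
    if n: "n \<in> cls p c (t0 + p ^ a * \<sigma>) N" for n
  proof -
    have "p ^ a dvd n - (t0 + p ^ a * \<sigma>)" using n pc by (auto simp: cls_def intro: dvd_mult_left)
    then obtain z where "n - (t0 + p ^ a * \<sigma>) = p ^ a * z" by (elim dvdE)
    then have "n = t0 + p ^ a * (\<sigma> + z)" by (simp add: algebra_simps)
    then show ?thesis using n *[of "\<sigma> + z"] by (auto simp: cls_def)
  qed
  then show ?thesis using * by (auto simp: cls_def)
qed

text \<open>Averaging over the translations of \<open>curve_local_phase\<close> reduces the claim to decoupling in dimension
  \<open>l\<close> on each coset. The case \<open>l = k\<close> with \<open>b = k * m\<close> is the rescaling of a residue class.\<close>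

lemma dec_transfer:
  assumes p: "prime p" and k: "int k < p" and \<gamma>: "curve p k \<gamma>" and N: "finite N"
    and l: "1 \<le> l" "l \<le> k" and t: "\<not> p dvd t0 - t1" and a: "1 \<le> a" "a \<le> c"
    and c: "c \<le> m" "l * c \<le> b * (k - l + 1)"
    and dec: "dec p l (c - a) K" and K: "K \<ge> 0" and e: "\<And>\<sigma>. \<sigma> \<in> {0..<p^(c-a)} \<Longrightarrow> e \<sigma> \<ge> 0"
    and Q: "Q = p ^ (k * m)"
    and le: "\<And>\<sigma>. \<sigma> \<in> {0..<p^(c-a)} \<Longrightarrow>
       avg k Q (\<lambda>x. energy k Q \<gamma> \<alpha> (cls p b t1 N) x ^ v * energy k Q \<gamma> \<alpha> (cls p c (t0 + p ^ a * \<sigma>) N) x ^ crit l) \<le> e \<sigma> ^ crit l"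
  shows "avg k Q (\<lambda>x. energy k Q \<gamma> \<alpha> (cls p b t1 N) x ^ v * energy k Q \<gamma> \<alpha> (cls p a t0 N) x ^ crit l)
     \<le> K * (\<Sum>\<sigma>\<in>{0..<p^(c-a)}. e \<sigma>) ^ crit l"
proof -
  have p1: "p > 1" using p by (simp add: prime_gt_1_int)
  have Q0: "Q > 0" using p1 by (simp add: Q)
  \<comment> \<open>\<open>R\<close> is the modulus of decoupling in dimension \<open>l\<close> at
    scale p^(c - a); \<open>D\<close>, the rest of \<open>Q\<close>, is the factor in front of
    \<open>\<eta>\<close> in \<open>curve_local_phase\<close>.\<close>
  define R where "R = p ^ (l * (c - a))"
  define D where "D = p ^ (k * m - l * (c - a))"
  have "l * (c - a) \<le> k * m" using l c by (intro mult_mono) auto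
  then have QDR: "Q = D * R" by (simp add: Q D_def R_def flip: power_add)
  have R0: "R > 0" and D0: "D \<noteq> 0" using p1 by (auto simp: R_def D_def)
  have r1: "crit l \<ge> 1"
  proof -
    have "2 \<le> l * (l + 1)" using l mult_le_mono[of 1 l 2 "l + 1"] by simp
    then show ?thesis unfolding crit_def by linarith
  qed
  from curve_local_phase[OF p k \<gamma> l(2) t a c] obtain \<eta> where \<eta>: "curve p l \<eta>"
    and ph: "\<And>u. \<exists>h C C'. (\<forall>s. Q dvd (\<Sum>j=1..k. h j * poly (\<gamma> j) (t0 + p ^ a * s))
            - (C + D * (\<Sum>i=1..l. u i * poly (\<eta> i) s))) \<and>
     (\<forall>y. Q dvd (\<Sum>j=1..k. h j * poly (\<gamma> j) (t1 + p ^ b * y)) - C')"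
    unfolding D_def Q by blast
  define w where "w = (\<lambda>x. energy k Q \<gamma> \<alpha> (cls p b t1 N) x ^ v)"
  have w0: "w x \<ge> 0" for x by (simp add: w_def)
  define \<beta> where "\<beta> = (\<lambda>x s. \<alpha> (t0 + p ^ a * s) * add_char Q (\<Sum>j=1..k. x j * poly (\<gamma> j) (t0 + p ^ a * s)))"
  define N' where "N' = {s. t0 + p ^ a * s \<in> N}"
  have finN': "finite N'"
  proof -
    have "inj_on (\<lambda>s. t0 + p ^ a * s) N'" using p1 by (auto simp: inj_on_def)
    moreover have "(\<lambda>s. t0 + p ^ a * s) ` N' \<subseteq> N" by (auto simp: N'_def)
    ultimately show ?thesis using N by (meson finite_imageD finite_subset)
  qed
  \<comment> \<open>\<open>u\<close> parametrizes the translations and becomes the variable dual to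
    \<open>\<eta>\<close>, while \<open>x\<close> survives only in \<open>w\<close> and in the
    coefficients \<open>\<beta> x\<close>.\<close>
  have key: "avg k Q (\<lambda>x. w x * energy k Q \<gamma> \<alpha> (cls p c' (t0 + p ^ a * \<sigma>) N) x ^ crit l)
      = avg k Q (\<lambda>x. w x * avg l R (\<lambda>u. energy l R \<eta> (\<beta> x) (cls p (c' - a) \<sigma> N') u ^ crit l))"
    if c': "a \<le> c'" for c' \<sigma>
  proof -
    define S where "S = cls p (c' - a) \<sigma> N'"
    define T where "T = cls p c' (t0 + p ^ a * \<sigma>) N"
    have T: "T = (\<lambda>s. t0 + p ^ a * s) ` S"
      unfolding T_def S_def N'_def using p1 c' by (intro cls_affine) auto
    have "avg k Q (\<lambda>x. w x * energy k Q \<gamma> \<alpha> T x ^ crit l) = avg k Q (\<lambda>x. w x * energy l R \<eta> (\<beta> x) S u ^ crit l)" for u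
    proof -
      obtain h C C' where h: "\<And>s. Q dvd (\<Sum>j=1..k. h j * poly (\<gamma> j) (t0 + p ^ a * s)) - (C + D * (\<Sum>i=1..l. u i * poly (\<eta> i) s))"
        and h': "\<And>y. Q dvd (\<Sum>j=1..k. h j * poly (\<gamma> j) (t1 + p ^ b * y)) - C'" using ph[of u] by blast
      have 1: "energy k Q \<gamma> \<alpha> T (\<lambda>i. x i + h i) = energy l R \<eta> (\<beta> x) S u" for x
      proof -
        have "expsum k (D * R) \<gamma> \<alpha> T (\<lambda>i. x i + h i) = add_char (D * R) C * expsum l R \<eta> (\<beta> x) S u"
          unfolding \<beta>_def QDR by (rule expsum_twist[OF T _ D0]) (use p1 h QDR in auto)
        then show ?thesis by (simp add: energy_def QDR norm_mult)
      qed
      have 2: "w (\<lambda>i. x i + h i) = w x" for x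
      proof -
        have "expsum k Q \<gamma> \<alpha> (cls p b t1 N) (\<lambda>i. x i + h i) = add_char Q C' * expsum k Q \<gamma> \<alpha> (cls p b t1 N) x"
          unfolding expsum_def sum_distrib_left
        proof (intro sum.cong refl)
          fix n assume "n \<in> cls p b t1 N"
          then obtain y where "n - t1 = p ^ b * y" unfolding cls_def by (auto elim: dvdE)
          then have y: "n = t1 + p ^ b * y" by simp
          have "(\<Sum>j=1..k. (x j + h j) * poly (\<gamma> j) n) = (\<Sum>j=1..k. x j * poly (\<gamma> j) n) + (\<Sum>j=1..k. h j * poly (\<gamma> j) n)"
            by (simp add: distrib_right sum.distrib)
          then have "add_char Q (\<Sum>j=1..k. (x j + h j) * poly (\<gamma> j) n) = add_char Q (\<Sum>j=1..k. x j * poly (\<gamma> j) n) * add_char Q C'"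
            using add_char_cong[OF h'[of y]] by (simp only: add_char_add y)
          then show "\<alpha> n * add_char Q (\<Sum>j=1..k. (x j + h j) * poly (\<gamma> j) n) =
             add_char Q C' * (\<alpha> n * add_char Q (\<Sum>j=1..k. x j * poly (\<gamma> j) n))" by simp
        qed
        then show ?thesis by (simp add: w_def energy_def norm_mult)
      qed
      have "torus_periodic k Q (\<lambda>x. w x * energy k Q \<gamma> \<alpha> T x ^ crit l)"
        using energy_periodic[of k Q \<gamma> \<alpha>] unfolding torus_periodic_def w_def by metis
      from avg_shift[OF Q0 this, of h] show ?thesis by (simp add: 1 2)
    qed
    then have "avg k Q (\<lambda>x. w x * energy k Q \<gamma> \<alpha> T x ^ crit l) =
       avg l R (\<lambda>u. avg k Q (\<lambda>x. w x * energy l R \<eta> (\<beta> x) S u ^ crit l))"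
      using avg_const[OF R0] by simp
    also have "\<dots> = avg k Q (\<lambda>x. avg l R (\<lambda>u. w x * energy l R \<eta> (\<beta> x) S u ^ crit l))"
      by (rule avg_swap[symmetric])
    finally show ?thesis by (simp add: avg_cmult S_def T_def)
  qed
  \<comment> \<open>Decoupling is applied in \<open>u\<close> for each fixed \<open>x\<close>, with
    the exact norms \<open>F \<sigma> x\<close> as bounds; Minkowski's inequality in
    \<open>x\<close> then moves the sum over \<open>\<sigma>\<close> outside the mean.\<close>
  define F where "F = (\<lambda>\<sigma> x. root (crit l) (avg l R (\<lambda>u. energy l R \<eta> (\<beta> x) (cls p (c - a) \<sigma> N') u ^ crit l)))"
  have Fpow: "F \<sigma> x ^ crit l = avg l R (\<lambda>u. energy l R \<eta> (\<beta> x) (cls p (c - a) \<sigma> N') u ^ crit l)" for \<sigma> x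
    unfolding F_def using r1 by (intro real_root_pow_pos2 avg_nonneg R0) auto
  have F0: "F \<sigma> x \<ge> 0" for \<sigma> x
    unfolding F_def using r1 by (intro real_root_ge_zero avg_nonneg R0) auto
  have "avg k Q (\<lambda>x. w x * energy k Q \<gamma> \<alpha> (cls p a t0 N) x ^ crit l)
     = avg k Q (\<lambda>x. w x * avg l R (\<lambda>u. energy l R \<eta> (\<beta> x) N' u ^ crit l))"
    using key[of a 0] by (simp add: cls_def)
  also have "\<dots> \<le> avg k Q (\<lambda>x. K * (w x * (\<Sum>\<sigma>\<in>{0..<p^(c-a)}. F \<sigma> x) ^ crit l))"
  proof (rule avg_mono[OF Q0])
    fix x
    have "avg l R (\<lambda>u. energy l R \<eta> (\<beta> x) N' u ^ crit l) \<le> K * (\<Sum>\<sigma>\<in>{0..<p^(c-a)}. F \<sigma> x) ^ crit l"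
      using dec[unfolded dec_def, rule_format, OF \<eta> finN', of "\<lambda>\<sigma>. F \<sigma> x" "\<beta> x"] F0 Fpow
      by (simp add: R_def)
    then show "w x * avg l R (\<lambda>u. energy l R \<eta> (\<beta> x) N' u ^ crit l) \<le> K * (w x * (\<Sum>\<sigma>\<in>{0..<p^(c-a)}. F \<sigma> x) ^ crit l)"
      using mult_left_mono[OF _ w0[of x]] by (metis mult.left_commute)
  qed
  also have "\<dots> = K * avg k Q (\<lambda>x. w x * (\<Sum>\<sigma>\<in>{0..<p^(c-a)}. F \<sigma> x) ^ crit l)" by (rule avg_cmult)
  also have "\<dots> \<le> K * (\<Sum>\<sigma>\<in>{0..<p^(c-a)}. e \<sigma>) ^ crit l"
  proof (rule mult_left_mono[OF avg_minkowski[OF Q0 _ r1 w0] K])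
    show "avg k Q (\<lambda>x. w x * F \<sigma> x ^ crit l) \<le> e \<sigma> ^ crit l" if "\<sigma> \<in> {0..<p^(c-a)}" for \<sigma>
      using le[OF that] key[OF a(2), of \<sigma>] by (simp add: Fpow w_def)
  qed (use F0 e in auto)
  finally show ?thesis by (simp add: w_def)
qed

section \<open>Bilinear estimates\<close>

lemma two_crit: "2 * crit k = k * (k + 1)"
  unfolding crit_def by (simp add: even_mult_iff)

lemma crit_pos: "1 \<le> k \<Longrightarrow> 1 \<le> crit k"
  using two_crit[of k] by (cases k) auto

lemma crit_less: assumes "l < k" shows "crit l < crit k"
proof -
  have "l * (l + 1) < k * (k + 1)" using assms by (intro mult_strict_mono) auto
  then show ?thesis using two_crit[of k] two_crit[of l] by linarith
qed

text \<open>With q = k - l, the exponents of index \<open>l\<close> are the weighted mean, with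
  weights 1 / (1 + q) and q / (1 + q), of those of index \<open>k - l\<close> with the two classes
  exchanged and those of index \<open>l - 1\<close>. This is what Hoelder's inequality needs in
  \<open>bil_holder\<close>.\<close>

lemma crit_exponents:
  assumes "1 \<le> l" "l < k"
  shows "crit l * (1 + (k - l)) = (crit k - crit (k - l)) + crit (l - 1) * (k - l)"
    and "(crit k - crit l) * (1 + (k - l)) = crit (k - l) + (crit k - crit (l - 1)) * (k - l)"
proof -
  have r: "real (crit j) = real j * (real j + 1) / 2" for j
    using two_crit[of j] by (metis (no_types, opaque_lifting) nonzero_mult_div_cancel_left of_nat_1 of_nat_add of_nat_mult of_nat_numeral zero_neq_numeral)
  have le: "crit (k - l) \<le> crit k" "crit l \<le> crit k" "crit (l - 1) \<le> crit k"
    by (rule less_imp_le[OF crit_less], use assms in linarith)+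
  have l: "real (k - l) = real k - real l" "real (l - 1) = real l - 1" using assms by auto
  have "real (crit l * (1 + (k - l))) = real ((crit k - crit (k - l)) + crit (l - 1) * (k - l))"
    unfolding of_nat_mult of_nat_add of_nat_diff[OF le(1)] r l by (simp add: field_simps)
  then show "crit l * (1 + (k - l)) = (crit k - crit (k - l)) + crit (l - 1) * (k - l)"
    using of_nat_eq_iff by blast
  have "real ((crit k - crit l) * (1 + (k - l))) = real (crit (k - l) + (crit k - crit (l - 1)) * (k - l))"
    unfolding of_nat_mult of_nat_add of_nat_diff[OF le(2)] of_nat_diff[OF le(3)] r l by (simp add: field_simps)
  then show "(crit k - crit l) * (1 + (k - l)) = crit (k - l) + (crit k - crit (l - 1)) * (k - l)"
    using of_nat_eq_iff by blast
qed

section \<open>Splitting residue classes into finer ones\<close>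

lemma cls_0 [simp]: "cls p 0 t N = N"
  by (simp add: cls_def)

lemma cls_mod: "cls p a (t mod p ^ a) N = cls p a t N"
proof -
  have "p ^ a dvd n - t mod p ^ a \<longleftrightarrow> p ^ a dvd n - t" for n
    by (simp add: mod_eq_dvd_iff[symmetric])
  then show ?thesis by (simp add: cls_def)
qed

lemma sum_cls:
  assumes p: "p > (0::int)" and ac: "a \<le> c" and N: "finite N"
  shows "(\<Sum>\<sigma>\<in>{0..<p^(c-a)}. sum f (cls p c (t + p ^ a * \<sigma>) N)) = sum f (cls p a t N)"
proof -
  have pc: "p ^ c = p ^ a * p ^ (c - a)" using ac by (simp flip: power_add)
  have ex: "\<exists>\<sigma>\<in>{0..<p^(c-a)}. n \<in> cls p c (t + p ^ a * \<sigma>) N" if n: "n \<in> cls p a t N" for n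
  proof -
    obtain z where z: "n - t = p ^ a * z" using n by (auto simp: cls_def elim: dvdE)
    have "n - (t + p ^ a * (z mod p ^ (c - a))) = p ^ a * (z - z mod p ^ (c - a))"
      using z by (simp add: algebra_simps)
    also have "p ^ c dvd \<dots>" unfolding pc by (intro mult_dvd_mono dvd_refl dvd_minus_mod)
    finally have "n \<in> cls p c (t + p ^ a * (z mod p ^ (c - a))) N" using n by (simp add: cls_def)
    moreover have "z mod p ^ (c - a) \<in> {0..<p^(c-a)}" using p by simp
    ultimately show ?thesis by blast
  qed
  have sub: "n \<in> cls p a t N" if "n \<in> cls p c (t + p ^ a * \<sigma>) N" for n \<sigma>
  proof -
    have "p ^ a dvd n - (t + p ^ a * \<sigma>)" using that pc by (auto simp: cls_def intro: dvd_mult_left)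
    then have "p ^ a dvd (n - (t + p ^ a * \<sigma>)) + p ^ a * \<sigma>" by (rule dvd_add) simp
    then show ?thesis using that by (simp add: cls_def)
  qed
  have dis: "\<sigma> = \<tau>" if "n \<in> cls p c (t + p ^ a * \<sigma>) N" "n \<in> cls p c (t + p ^ a * \<tau>) N"
    "\<sigma> \<in> {0..<p^(c-a)}" "\<tau> \<in> {0..<p^(c-a)}" for n \<sigma> \<tau>
  proof -
    have "p ^ c dvd (n - (t + p ^ a * \<tau>)) - (n - (t + p ^ a * \<sigma>))"
      by (rule dvd_diff) (use that in \<open>auto simp: cls_def\<close>)
    also have "(n - (t + p ^ a * \<tau>)) - (n - (t + p ^ a * \<sigma>)) = p ^ a * (\<sigma> - \<tau>)" by (simp add: algebra_simps)
    finally have "p ^ (c - a) dvd \<sigma> - \<tau>" using p by (simp add: pc)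
    then have "\<sigma> mod p ^ (c - a) = \<tau> mod p ^ (c - a)" by (simp add: mod_eq_dvd_iff)
    then show ?thesis using that by simp
  qed
  have "cls p a t N = (\<Union>\<sigma>\<in>{0..<p^(c-a)}. cls p c (t + p ^ a * \<sigma>) N)" using ex sub by blast
  moreover have "sum f (\<Union>\<sigma>\<in>{0..<p^(c-a)}. cls p c (t + p ^ a * \<sigma>) N) =
      (\<Sum>\<sigma>\<in>{0..<p^(c-a)}. sum f (cls p c (t + p ^ a * \<sigma>) N))"
    by (rule sum.UNION_disjoint) (use N dis in auto)
  ultimately show ?thesis by simp
qed

lemma expsum_cls:
  assumes "p > (0::int)" "a \<le> c" "finite N"
  shows "expsum k Q \<gamma> \<alpha> (cls p a t N) x = (\<Sum>\<sigma>\<in>{0..<p^(c-a)}. expsum k Q \<gamma> \<alpha> (cls p c (t + p ^ a * \<sigma>) N) x)"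
  unfolding expsum_def by (rule sum_cls[OF assms, symmetric])

lemma energy_cls_le:
  assumes p: "p > (0::int)" and "a \<le> c" "finite N"
  shows "energy k Q \<gamma> \<alpha> (cls p a t N) x \<le> real_of_int (p ^ (c - a)) *
     (\<Sum>\<sigma>\<in>{0..<p^(c-a)}. energy k Q \<gamma> \<alpha> (cls p c (t + p ^ a * \<sigma>) N) x)"
proof -
  let ?f = "\<lambda>\<sigma>. cmod (expsum k Q \<gamma> \<alpha> (cls p c (t + p ^ a * \<sigma>) N) x)"
  have "energy k Q \<gamma> \<alpha> (cls p a t N) x \<le> (\<Sum>\<sigma>\<in>{0..<p^(c-a)}. ?f \<sigma>)\<^sup>2"
    unfolding energy_def expsum_cls[OF assms] by (intro power_mono norm_sum) auto
  also have "\<dots> \<le> (\<Sum>\<sigma>\<in>{0..<p^(c-a)}. (?f \<sigma>)\<^sup>2) * real (card {0..<p^(c-a)})"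
    by (rule sum_squared_le_sum_of_squares)
  also have "real (card {0..<p^(c-a)}) = real_of_int (p ^ (c - a))" using p by simp
  finally show ?thesis by (simp add: energy_def mult.commute)
qed

text \<open>One instance of the hypotheses of \<open>dec\<close>. Means of \<open>F a t\<close>, the
  energy of a class modulo p^a, are compared with \<open>S a t\<close>, the sum of the given bounds
  over the classes modulo p^m inside it.\<close>

locale expsum_data =
  fixes p :: int and k m :: nat and \<gamma> :: "nat \<Rightarrow> int poly" and N :: "int set"
    and \<alpha> :: "int \<Rightarrow> complex" and d :: "int \<Rightarrow> real"
  assumes p: "prime p" and kp: "int k < p" and k1: "1 \<le> k" and \<gamma>: "curve p k \<gamma>" and N: "finite N"
    and d: "\<And>\<rho>. \<rho> \<in> {0..<p^m} \<Longrightarrow> d \<rho> \<ge> 0"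
    and dle: "\<And>\<rho>. \<rho> \<in> {0..<p^m} \<Longrightarrow>
      avg k (p ^ (k * m)) (\<lambda>x. energy k (p ^ (k * m)) \<gamma> \<alpha> (cls p m \<rho> N) x ^ crit k) \<le> d \<rho> ^ crit k"
begin

definition F :: "nat \<Rightarrow> int \<Rightarrow> (nat \<Rightarrow> int) \<Rightarrow> real" where
  "F a t = energy k (p ^ (k * m)) \<gamma> \<alpha> (cls p a t N)"

definition S :: "nat \<Rightarrow> int \<Rightarrow> real" where
  "S a t = sum d (cls p a t {0..<p^m})"

definition av :: "((nat \<Rightarrow> int) \<Rightarrow> real) \<Rightarrow> real" where
  "av = avg k (p ^ (k * m))"

text \<open>Both sides have the same degree \<open>crit k\<close>, so \<open>M\<close> is normalized
  like \<open>K\<close> in \<open>dec\<close>. The exponent \<open>crit l\<close> belongs to the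
  class modulo p^a; for l = 0 only the class modulo p^b is left.\<close>

definition bil :: "nat \<Rightarrow> nat \<Rightarrow> nat \<Rightarrow> real \<Rightarrow> bool" where
  "bil l a b M \<longleftrightarrow> (\<forall>t t'. \<not> p dvd t - t' \<longrightarrow>
     av (\<lambda>x. F b t' x ^ (crit k - crit l) * F a t x ^ crit l) \<le> M * (S b t' ^ (crit k - crit l) * S a t ^ crit l))"

lemma p1: "p > 1" using p by (simp add: prime_gt_1_int)

lemma Q0: "p ^ (k * m) > 0" using p1 by simp

lemma F0 [simp]: "F a t x \<ge> 0" by (simp add: F_def)

lemma S0 [simp]: "S a t \<ge> 0"
  unfolding S_def by (intro sum_nonneg d) (simp add: cls_def)

lemma av_nonneg: "(\<And>x. G x \<ge> 0) \<Longrightarrow> av G \<ge> 0"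
  unfolding av_def by (rule avg_nonneg[OF Q0])

lemma bil_mono: "bil l a b M \<Longrightarrow> M \<le> M' \<Longrightarrow> bil l a b M'"
  unfolding bil_def by (meson S0 mult_nonneg_nonneg mult_right_mono order_trans zero_le_power)

lemma sum_S: "a \<le> c \<Longrightarrow> (\<Sum>\<sigma>\<in>{0..<p^(c-a)}. S c (t + p ^ a * \<sigma>)) = S a t"
  unfolding S_def using p1 by (intro sum_cls) auto

lemma av_leaf: "av (\<lambda>x. F m t x ^ crit k) \<le> S m t ^ crit k"
proof -
  define \<rho> where "\<rho> = t mod p ^ m"
  have \<rho>: "\<rho> \<in> {0..<p^m}" using p1 by (simp add: \<rho>_def)
  have "n = \<rho>" if "n \<in> {0..<p^m}" "p ^ m dvd n - \<rho>" for n
  proof -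
    have "n mod p ^ m = \<rho> mod p ^ m" using that(2) by (simp add: mod_eq_dvd_iff)
    moreover have "n mod p ^ m = n" "\<rho> mod p ^ m = \<rho>" using that \<rho> by (simp_all del: mod_mod_trivial)
    ultimately show ?thesis by simp
  qed
  then have "cls p m t {0..<p^m} = {\<rho>}"
    unfolding cls_mod[of p m t, symmetric] \<rho>_def[symmetric] using \<rho> by (auto simp: cls_def)
  then have "S m t = d \<rho>" by (simp add: S_def)
  then show ?thesis using dle[OF \<rho>] by (simp add: av_def F_def \<rho>_def cls_mod)
qed

lemma av_rescale:
  assumes a: "1 \<le> a" "a \<le> m" and dec: "dec p k (m - a) K" and K: "K \<ge> 0"
  shows "av (\<lambda>x. F a t x ^ crit k) \<le> K * S a t ^ crit k"
proof -
  \<comment> \<open>The second class in \<open>dec_transfer\<close> gets exponent 0;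
    \<open>t + 1\<close> supplies a residue incongruent to \<open>t\<close>.\<close>
  have t: "\<not> p dvd t - (t + 1)" using p1 by simp
  have "avg k (p ^ (k * m)) (\<lambda>x. energy k (p ^ (k * m)) \<gamma> \<alpha> (cls p (k * m) (t + 1) N) x ^ 0 *
      energy k (p ^ (k * m)) \<gamma> \<alpha> (cls p a t N) x ^ crit k)
     \<le> K * (\<Sum>\<sigma>\<in>{0..<p^(m-a)}. S m (t + p ^ a * \<sigma>)) ^ crit k"
  proof (rule dec_transfer[OF p kp \<gamma> N k1 le_refl t a le_refl _ dec K _ refl])
    show "k * m \<le> k * m * (k - k + 1)" by simp
    show "avg k (p ^ (k * m)) (\<lambda>x. energy k (p ^ (k * m)) \<gamma> \<alpha> (cls p (k * m) (t + 1) N) x ^ 0 *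
      energy k (p ^ (k * m)) \<gamma> \<alpha> (cls p m (t + p ^ a * \<sigma>) N) x ^ crit k) \<le> S m (t + p ^ a * \<sigma>) ^ crit k" for \<sigma>
      using av_leaf[of "t + p ^ a * \<sigma>"] by (simp add: av_def F_def)
  qed auto
  then show ?thesis using a by (simp add: sum_S av_def F_def)
qed

lemma bil_refine:
  assumes l: "1 \<le> l" "l < k" and a: "1 \<le> a" "a \<le> c" and c: "c \<le> m" "l * c \<le> b * (k - l + 1)"
    and dec: "dec p l (c - a) K" and K: "K \<ge> 0" and M: "M \<ge> 0" and bil: "bil l c b M"
  shows "bil l a b (K * M)"
  unfolding bil_def
proof (intro allI impI)
  fix t t' assume t: "\<not> p dvd t - t'"
  have r1: "crit l \<ge> 1" using l crit_pos by simp
  \<comment> \<open>\<open>dec_transfer\<close> expects bounds that are powers with exponent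
    \<open>crit l\<close>; the factor common to all \<open>\<sigma>\<close> is written as such a
    power.\<close>
  define q where "q = root (crit l) (M * S b t' ^ (crit k - crit l))"
  have q: "q ^ crit l = M * S b t' ^ (crit k - crit l)"
    unfolding q_def using M r1 by (intro real_root_pow_pos2) auto
  have q0: "q \<ge> 0" unfolding q_def using M r1 by (intro real_root_ge_zero) auto
  have "avg k (p ^ (k * m)) (\<lambda>x. energy k (p ^ (k * m)) \<gamma> \<alpha> (cls p b t' N) x ^ (crit k - crit l) *
      energy k (p ^ (k * m)) \<gamma> \<alpha> (cls p a t N) x ^ crit l)
     \<le> K * (\<Sum>\<sigma>\<in>{0..<p^(c-a)}. q * S c (t + p ^ a * \<sigma>)) ^ crit l"
  proof (rule dec_transfer[OF p kp \<gamma> N l(1) less_imp_le[OF l(2)] t a c dec K _ refl])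
    fix \<sigma>
    have "\<not> p dvd (t + p ^ a * \<sigma>) - t'"
    proof
      assume "p dvd (t + p ^ a * \<sigma>) - t'"
      moreover have "p dvd p ^ a * \<sigma>" using a by (intro dvd_mult2 dvd_power) auto
      ultimately have "p dvd ((t + p ^ a * \<sigma>) - t') - p ^ a * \<sigma>" by (rule dvd_diff)
      then show False using t by simp
    qed
    then have "av (\<lambda>x. F b t' x ^ (crit k - crit l) * F c (t + p ^ a * \<sigma>) x ^ crit l)
      \<le> M * (S b t' ^ (crit k - crit l) * S c (t + p ^ a * \<sigma>) ^ crit l)"
      using bil unfolding bil_def by blast
    then show "avg k (p ^ (k * m)) (\<lambda>x. energy k (p ^ (k * m)) \<gamma> \<alpha> (cls p b t' N) x ^ (crit k - crit l) *
      energy k (p ^ (k * m)) \<gamma> \<alpha> (cls p c (t + p ^ a * \<sigma>) N) x ^ crit l) \<le> (q * S c (t + p ^ a * \<sigma>)) ^ crit l"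
      by (simp add: av_def F_def power_mult_distrib q mult.assoc)
    show "0 \<le> q * S c (t + p ^ a * \<sigma>)" using q0 by simp
  qed
  also have "(\<Sum>\<sigma>\<in>{0..<p^(c-a)}. q * S c (t + p ^ a * \<sigma>)) = q * S a t"
    unfolding sum_distrib_left[symmetric] using a by (simp add: sum_S)
  finally show "av (\<lambda>x. F b t' x ^ (crit k - crit l) * F a t x ^ crit l) \<le> K * M * (S b t' ^ (crit k - crit l) * S a t ^ crit l)"
    by (simp add: av_def F_def power_mult_distrib q mult.assoc)
qed

lemma bil_holder:
  assumes l: "1 \<le> l" "l < k" and M1: "bil (k - l) b a M1" "M1 \<ge> 0" and M2: "bil (l - 1) a b M2" "M2 \<ge> 0"
    and M: "M \<ge> 0" "M ^ (1 + (k - l)) = M1 * M2 ^ (k - l)"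
  shows "bil l a b M"
  unfolding bil_def
proof (intro allI impI)
  fix t t' assume t: "\<not> p dvd t - t'"
  then have t2: "\<not> p dvd t' - t" by (simp add: dvd_diff_commute)
  let ?q = "k - l"
  let ?Z = "\<lambda>u v :: real. u ^ (crit k - crit l) * v ^ crit l"
  let ?X = "\<lambda>u v :: real. v ^ (crit k - crit ?q) * u ^ crit ?q"
  let ?Y = "\<lambda>u v :: real. u ^ (crit k - crit (l - 1)) * v ^ crit (l - 1)"
  have eq: "?Z u v ^ (1 + ?q) = ?X u v ^ 1 * ?Y u v ^ ?q" for u v
  proof -
    have "?Z u v ^ (1 + ?q) = u ^ ((crit k - crit l) * (1 + ?q)) * v ^ (crit l * (1 + ?q))"
      by (simp only: power_mult_distrib power_mult[symmetric])
    also have "\<dots> = ?X u v ^ 1 * ?Y u v ^ ?q"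
      unfolding crit_exponents[OF l] by (simp only: power_mult_distrib power_mult[symmetric] power_add power_one_right mult_ac)
    finally show ?thesis .
  qed
  have "av (\<lambda>x. ?Z (F b t' x) (F a t x)) ^ (1 + ?q) \<le> av (\<lambda>x. ?X (F b t' x) (F a t x)) ^ 1 * av (\<lambda>x. ?Y (F b t' x) (F a t x)) ^ ?q"
    unfolding av_def by (rule avg_holder[OF Q0]) (use l eq in auto)
  also have "\<dots> \<le> (M1 * ?X (S b t') (S a t)) ^ 1 * (M2 * ?Y (S b t') (S a t)) ^ ?q"
  proof (intro mult_mono power_mono)
    show "av (\<lambda>x. ?X (F b t' x) (F a t x)) \<le> M1 * ?X (S b t') (S a t)"
      using M1 t2 unfolding bil_def by blast
    show "av (\<lambda>x. ?Y (F b t' x) (F a t x)) \<le> M2 * ?Y (S b t') (S a t)"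
      using M2 t unfolding bil_def by blast
  qed (use M1 in \<open>auto intro!: av_nonneg zero_le_power\<close>)
  also have "\<dots> = (M1 * M2 ^ ?q) * (?X (S b t') (S a t) ^ 1 * ?Y (S b t') (S a t) ^ ?q)"
    by (simp only: power_mult_distrib power_one_right mult_ac)
  also have "\<dots> = (M * ?Z (S b t') (S a t)) ^ (1 + ?q)"
    unfolding eq[symmetric] M(2)[symmetric] by (simp only: power_mult_distrib)
  finally show "av (\<lambda>x. ?Z (F b t' x) (F a t x)) \<le> M * ?Z (S b t') (S a t)"
    by (rule power_le_imp_le_base[of _ "k - l", unfolded Suc_eq_plus1_left]) (use M in auto)
qed

text \<open>The source of all gain: only the class modulo p^b remains, and after rescaling it is
  decoupled over m - b instead of m scales.\<close>

lemma bil_zero: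
  assumes "1 \<le> b" "b \<le> m" "dec p k (m - b) K" "K \<ge> 0"
  shows "bil 0 a b K"
  using av_rescale[OF assms] by (simp add: bil_def crit_def[of 0])

text \<open>The start of the iteration: Hoelder's inequality separates the two classes, and each is
  bounded linearly.\<close>

lemma bil_base:
  assumes l: "1 \<le> l" "l < k" and a: "1 \<le> a" "a \<le> m" "dec p k (m - a) K" and b: "1 \<le> b" "b \<le> m" "dec p k (m - b) K"
    and K: "K \<ge> 0"
  shows "bil l a b K"
  unfolding bil_def
proof (intro allI impI)
  fix t t'
  let ?i = "crit k - crit l" and ?j = "crit l"
  have ij: "?i \<ge> 1" "?j \<ge> 1" using crit_less[OF l(2)] crit_pos[OF l(1)] by auto
  have sum: "?i + ?j = crit k" using crit_less[OF l(2)] by simp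
  have "av (\<lambda>x. F b t' x ^ ?i * F a t x ^ ?j) ^ (?i + ?j) \<le>
     av (\<lambda>x. F b t' x ^ crit k) ^ ?i * av (\<lambda>x. F a t x ^ crit k) ^ ?j"
    unfolding av_def
  proof (rule avg_holder[OF Q0 _ _ _ ij])
    show "(F b t' x ^ ?i * F a t x ^ ?j) ^ (?i + ?j) = (F b t' x ^ crit k) ^ ?i * (F a t x ^ crit k) ^ ?j" for x
      unfolding sum power_mult_distrib power_mult[symmetric] by (simp only: mult.commute)
  qed auto
  also have "\<dots> \<le> (K * S b t' ^ crit k) ^ ?i * (K * S a t ^ crit k) ^ ?j"
    using K by (intro mult_mono power_mono av_rescale a b) (auto intro!: av_nonneg zero_le_power)
  also have "\<dots> = K ^ (?i + ?j) * ((S b t' ^ crit k) ^ ?i * (S a t ^ crit k) ^ ?j)"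
    by (simp only: power_mult_distrib power_add mult_ac)
  also have "(S b t' ^ crit k) ^ ?i * (S a t ^ crit k) ^ ?j = (S b t' ^ ?i * S a t ^ ?j) ^ (?i + ?j)"
    unfolding sum power_mult_distrib power_mult[symmetric] by (simp only: mult.commute)
  also have "K ^ (?i + ?j) * \<dots> = (K * (S b t' ^ ?i * S a t ^ ?j)) ^ (?i + ?j)"
    by (simp only: power_mult_distrib)
  finally show "av (\<lambda>x. F b t' x ^ ?i * F a t x ^ ?j) \<le> K * (S b t' ^ ?i * S a t ^ ?j)"
    using K ij by (subst (asm) power_mono_iff) (auto intro!: av_nonneg)
qed

text \<open>The way back from a fine second class to a coarse one: Cauchy-Schwarz over p^(b - 1)
  subclasses, then Minkowski's inequality. The loss is a fixed power of p^(b - 1), whatever the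
  number of rounds.\<close>

lemma bil_split:
  assumes l: "1 \<le> l" "l < k" and b: "1 \<le> b" and M: "M \<ge> 0" "bil l 1 b M"
  shows "bil l 1 1 (real_of_int (p ^ (b - 1)) ^ (crit k - crit l) * M)"
  unfolding bil_def
proof (intro allI impI)
  fix t t' assume t: "\<not> p dvd t - t'"
  define r where "r = crit k - crit l"
  define P where "P = real_of_int (p ^ (b - 1))"
  have r1: "r \<ge> 1" using crit_less[OF l(2)] by (simp add: r_def)
  have P0: "P > 0" using p1 by (simp add: P_def)
  define q where "q = root r (M * S 1 t ^ crit l)"
  have q: "q ^ r = M * S 1 t ^ crit l"
    unfolding q_def using M r1 by (intro real_root_pow_pos2) auto
  have q0: "q \<ge> 0" unfolding q_def using M r1 by (intro real_root_ge_zero) auto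
  have le: "F 1 t' x \<le> P * (\<Sum>\<sigma>\<in>{0..<p^(b-1)}. F b (t' + p ^ 1 * \<sigma>) x)" for x
    unfolding F_def P_def using p1 b N by (intro energy_cls_le) auto
  have "av (\<lambda>x. F 1 t' x ^ r * F 1 t x ^ crit l) \<le> av (\<lambda>x. P ^ r * (F 1 t x ^ crit l * (\<Sum>\<sigma>\<in>{0..<p^(b-1)}. F b (t' + p ^ 1 * \<sigma>) x) ^ r))"
    unfolding av_def
  proof (rule avg_mono[OF Q0])
    fix x
    have "F 1 t' x ^ r \<le> (P * (\<Sum>\<sigma>\<in>{0..<p^(b-1)}. F b (t' + p ^ 1 * \<sigma>) x)) ^ r"
      by (intro power_mono le) auto
    then have "F 1 t' x ^ r * F 1 t x ^ crit l \<le> (P * (\<Sum>\<sigma>\<in>{0..<p^(b-1)}. F b (t' + p ^ 1 * \<sigma>) x)) ^ r * F 1 t x ^ crit l"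
      by (rule mult_right_mono) simp
    then show "F 1 t' x ^ r * F 1 t x ^ crit l \<le> P ^ r * (F 1 t x ^ crit l * (\<Sum>\<sigma>\<in>{0..<p^(b-1)}. F b (t' + p ^ 1 * \<sigma>) x) ^ r)"
      by (simp only: power_mult_distrib mult_ac)
  qed
  also have "\<dots> = P ^ r * av (\<lambda>x. F 1 t x ^ crit l * (\<Sum>\<sigma>\<in>{0..<p^(b-1)}. F b (t' + p ^ 1 * \<sigma>) x) ^ r)"
    unfolding av_def by (rule avg_cmult)
  also have "\<dots> \<le> P ^ r * (\<Sum>\<sigma>\<in>{0..<p^(b-1)}. q * S b (t' + p ^ 1 * \<sigma>)) ^ r"
  proof (rule mult_left_mono)
    show "av (\<lambda>x. F 1 t x ^ crit l * (\<Sum>\<sigma>\<in>{0..<p^(b-1)}. F b (t' + p ^ 1 * \<sigma>) x) ^ r) \<le> (\<Sum>\<sigma>\<in>{0..<p^(b-1)}. q * S b (t' + p ^ 1 * \<sigma>)) ^ r"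
      unfolding av_def
    proof (rule avg_minkowski[OF Q0 _ r1])
      fix \<sigma>
      have "\<not> p dvd t - (t' + p ^ 1 * \<sigma>)"
      proof
        assume "p dvd t - (t' + p ^ 1 * \<sigma>)"
        then have "p dvd t - (t' + p ^ 1 * \<sigma>) + p * \<sigma>" by (rule dvd_add) simp
        then show False using t by simp
      qed
      then have "av (\<lambda>x. F b (t' + p ^ 1 * \<sigma>) x ^ r * F 1 t x ^ crit l) \<le> M * (S b (t' + p ^ 1 * \<sigma>) ^ r * S 1 t ^ crit l)"
        using M(2) unfolding bil_def r_def by blast
      also have "\<dots> = (q * S b (t' + p ^ 1 * \<sigma>)) ^ r" by (simp add: power_mult_distrib q)
      finally show "avg k (p ^ (k * m)) (\<lambda>x. F 1 t x ^ crit l * F b (t' + p ^ 1 * \<sigma>) x ^ r) \<le> (q * S b (t' + p ^ 1 * \<sigma>)) ^ r"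
        by (simp only: av_def mult.commute)
    qed (use q0 in auto)
  qed (use P0 in simp)
  also have "(\<Sum>\<sigma>\<in>{0..<p^(b-1)}. q * S b (t' + p ^ 1 * \<sigma>)) = q * S 1 t'"
    unfolding sum_distrib_left[symmetric] using b by (subst sum_S) auto
  also have "P ^ r * (q * S 1 t') ^ r = P ^ r * M * (S 1 t' ^ r * S 1 t ^ crit l)"
    by (simp add: power_mult_distrib q)
  finally show "av (\<lambda>x. F 1 t' x ^ (crit k - crit l) * F 1 t x ^ crit l)
     \<le> real_of_int (p ^ (b - 1)) ^ (crit k - crit l) * M * (S 1 t' ^ (crit k - crit l) * S 1 t ^ crit l)"
    by (simp only: r_def P_def)
qed

text \<open>The bound is used for the pair of classes in both orders. In the product of the two
  integrands each class has exponent \<open>crit k\<close>, and Cauchy-Schwarz gives the geometric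
  mean.\<close>

lemma bil_symmetric:
  assumes l: "l < k" and M: "bil l 1 1 M" "M \<ge> 0" and t: "\<not> p dvd t - t'"
  shows "av (\<lambda>x. (sqrt (F 1 t x) * sqrt (F 1 t' x)) ^ crit k) \<le> M * S 0 0 ^ crit k"
proof -
  let ?i = "crit k - crit l" and ?j = "crit l"
  have sum: "?i + ?j = crit k" using crit_less[OF l] by simp
  have t2: "\<not> p dvd t' - t" using t by (simp add: dvd_diff_commute)
  have SS: "S 1 u \<le> S 0 0" for u
    unfolding S_def by (rule sum_mono2) (auto simp: cls_def intro!: d)
  have Sle: "S 1 u ^ ?i * S 1 v ^ ?j \<le> S 0 0 ^ crit k" for u v
  proof -
    have "S 1 u ^ ?i * S 1 v ^ ?j \<le> S 0 0 ^ ?i * S 0 0 ^ ?j" by (intro mult_mono power_mono SS) auto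
    then show ?thesis by (simp only: power_add[symmetric] sum)
  qed
  have B: "av (\<lambda>x. F 1 v x ^ ?i * F 1 u x ^ ?j) \<le> M * S 0 0 ^ crit k" if "\<not> p dvd u - v" for u v
  proof -
    have "av (\<lambda>x. F 1 v x ^ ?i * F 1 u x ^ ?j) \<le> M * (S 1 v ^ ?i * S 1 u ^ ?j)"
      using M that unfolding bil_def by blast
    also have "\<dots> \<le> M * S 0 0 ^ crit k" by (intro mult_left_mono Sle M)
    finally show ?thesis .
  qed
  have "av (\<lambda>x. (sqrt (F 1 t x) * sqrt (F 1 t' x)) ^ crit k) ^ (1 + 1) \<le>
     av (\<lambda>x. F 1 t x ^ ?i * F 1 t' x ^ ?j) ^ 1 * av (\<lambda>x. F 1 t' x ^ ?i * F 1 t x ^ ?j) ^ 1"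
    unfolding av_def
  proof (rule avg_holder[OF Q0])
    fix x
    have "((sqrt (F 1 t x) * sqrt (F 1 t' x)) ^ crit k) ^ (1 + 1) = (F 1 t x * F 1 t' x) ^ crit k"
    proof -
      have "((sqrt (F 1 t x) * sqrt (F 1 t' x)) ^ crit k) ^ (1 + 1) = ((sqrt (F 1 t x) * sqrt (F 1 t' x)) ^ 2) ^ crit k"
        by (simp only: power_mult[symmetric] mult.commute one_add_one)
      then show ?thesis by (simp add: power_mult_distrib)
    qed
    also have "\<dots> = (F 1 t x * F 1 t' x) ^ (?i + ?j)" by (simp only: sum)
    also have "\<dots> = (F 1 t x ^ ?i * F 1 t' x ^ ?j) ^ 1 * (F 1 t' x ^ ?i * F 1 t x ^ ?j) ^ 1"
      by (simp only: power_add power_mult_distrib power_one_right mult_ac)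
    finally show "((sqrt (F 1 t x) * sqrt (F 1 t' x)) ^ crit k) ^ (1 + 1) =
      (F 1 t x ^ ?i * F 1 t' x ^ ?j) ^ 1 * (F 1 t' x ^ ?i * F 1 t x ^ ?j) ^ 1" .
  qed auto
  also have "\<dots> \<le> (M * S 0 0 ^ crit k) ^ 1 * (M * S 0 0 ^ crit k) ^ 1"
    by (intro mult_mono power_mono B t t2) (use M in \<open>auto intro!: av_nonneg\<close>)
  also have "\<dots> = (M * S 0 0 ^ crit k) ^ (1 + 1)" by simp
  finally show ?thesis by (rule power_le_imp_le_base[of _ 1, unfolded Suc_eq_plus1_left]) (use M in auto)
qed

text \<open>Squaring the sum over the classes modulo \<open>p\<close> produces pairs. Diagonal pairs
  are rescaled and contribute \<open>K\<close> with coefficient 1, which is what allows iteration in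
  \<open>m\<close>; the other pairs are bilinear, and there are fewer than p^2 of them.\<close>

lemma av_bilinear:
  assumes m: "1 \<le> m" and l: "l < k" and K: "K \<ge> 0" "dec p k (m - 1) (K ^ crit k)" and M: "M \<ge> 0" "bil l 1 1 (M ^ crit k)"
  shows "av (\<lambda>x. F 0 0 x ^ crit k) \<le> ((K + real_of_int p ^ 2 * M) * S 0 0) ^ crit k"
proof -
  define T where "T = {0..<p} \<times> {0..<p}"
  define G where "G = (\<lambda>(\<tau>, \<tau>') x. sqrt (F 1 \<tau> x) * sqrt (F 1 \<tau>' x))"
  \<comment> \<open>The bilinear term is kept on the diagonal as well, so that the total is exactly
    \<open>(K + p^2 * M) * S 0 0\<close>.\<close>
  define e where "e = (\<lambda>(\<tau>, \<tau>'). (if \<tau> = \<tau>' then K * S 1 \<tau> else 0) + M * S 0 0)"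
  have p0: "0 \<le> p" using p1 by simp
  have S1: "(\<Sum>\<tau>\<in>{0..<p}. S 1 \<tau>) = S 0 0" using sum_S[of 0 1 0] by simp
  have "F 0 0 x \<le> (\<Sum>\<tau>\<in>T. G \<tau> x)" for x
  proof -
    have "F 0 0 x \<le> (\<Sum>\<sigma>\<in>{0..<p}. sqrt (F 1 \<sigma> x))\<^sup>2"
      unfolding F_def energy_def real_sqrt_abs using expsum_cls[of p 0 1 N k "p ^ (k * m)" \<gamma> \<alpha> 0 x] p1 N
      by (auto intro!: power_mono norm_sum)
    also have "\<dots> = (\<Sum>\<tau>\<in>T. G \<tau> x)"
      by (simp add: power2_eq_square sum_product T_def G_def sum.cartesian_product split_def)
    finally show ?thesis .
  qed
  then have "av (\<lambda>x. F 0 0 x ^ crit k) \<le> av (\<lambda>x. 1 * (\<Sum>\<tau>\<in>T. G \<tau> x) ^ crit k)"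
    unfolding av_def by (intro avg_mono Q0) (auto intro!: power_mono)
  also have "\<dots> \<le> (\<Sum>\<tau>\<in>T. e \<tau>) ^ crit k"
    unfolding av_def
  proof (rule avg_minkowski[OF Q0 _ crit_pos[OF k1]])
    fix \<tau>\<tau> assume "\<tau>\<tau> \<in> T"
    then obtain \<tau> \<tau>' where \<tau>: "\<tau>\<tau> = (\<tau>, \<tau>')" "\<tau> \<in> {0..<p}" "\<tau>' \<in> {0..<p}" by (auto simp: T_def)
    show "0 \<le> e \<tau>\<tau>" using K M by (simp add: e_def \<tau>)
    show "0 \<le> G \<tau>\<tau> x" for x by (simp add: G_def \<tau>)
    show "avg k (p ^ (k * m)) (\<lambda>x. 1 * G \<tau>\<tau> x ^ crit k) \<le> e \<tau>\<tau> ^ crit k"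
    proof (cases "\<tau> = \<tau>'")
      case True
      have "av (\<lambda>x. F 1 \<tau> x ^ crit k) \<le> K ^ crit k * S 1 \<tau> ^ crit k"
        using m K by (intro av_rescale) auto
      also have "\<dots> = (K * S 1 \<tau>) ^ crit k" by (simp add: power_mult_distrib)
      also have "\<dots> \<le> e \<tau>\<tau> ^ crit k" using True \<tau> K M by (intro power_mono) (auto simp: e_def)
      finally show ?thesis using True \<tau> by (simp add: av_def G_def)
    next
      case False
      have "\<not> p dvd \<tau> - \<tau>'"
      proof
        assume "p dvd \<tau> - \<tau>'"
        then have "\<tau> mod p = \<tau>' mod p" by (simp add: mod_eq_dvd_iff)
        then show False using False \<tau> by simp
      qed
      from bil_symmetric[OF l M(2) _ this]
      have "av (\<lambda>x. (sqrt (F 1 \<tau> x) * sqrt (F 1 \<tau>' x)) ^ crit k) \<le> M ^ crit k * S 0 0 ^ crit k" using M by simp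
      then show ?thesis using False \<tau> by (simp add: av_def G_def e_def power_mult_distrib)
    qed
  qed (simp_all add: T_def)
  also have "(\<Sum>\<tau>\<in>T. e \<tau>) = (K + real_of_int p ^ 2 * M) * S 0 0"
  proof -
    have "(\<Sum>\<tau>\<in>T. e \<tau>) = (\<Sum>\<tau>\<in>{0..<p}. \<Sum>\<tau>'\<in>{0..<p}. (if \<tau> = \<tau>' then K * S 1 \<tau> else 0) + M * S 0 0)"
      by (simp add: T_def e_def sum.cartesian_product)
    also have "\<dots> = (\<Sum>\<tau>\<in>{0..<p}. K * S 1 \<tau> + p * (M * S 0 0))"
      by (intro sum.cong refl) (simp add: sum.distrib p0)
    also have "\<dots> = K * S 0 0 + p * (p * (M * S 0 0))"
      by (simp add: sum.distrib sum_distrib_left[symmetric] S1[unfolded One_nat_def] p0)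
    finally show ?thesis by (simp add: algebra_simps power2_eq_square)
  qed
  finally show ?thesis .
qed

lemma av_trivial: "av (\<lambda>x. F 0 0 x ^ crit k) \<le> real_of_int p ^ (m * crit k) * S 0 0 ^ crit k"
proof -
  define P where "P = real_of_int (p ^ m)"
  have P0: "P > 0" using p1 by (simp add: P_def)
  have le: "F 0 0 x \<le> P * (\<Sum>\<sigma>\<in>{0..<p^m}. F m \<sigma> x)" for x
    using energy_cls_le[of p 0 m N k "p ^ (k * m)" \<gamma> \<alpha> 0 x] p1 N by (simp add: F_def P_def)
  have "av (\<lambda>x. F 0 0 x ^ crit k) \<le> av (\<lambda>x. P ^ crit k * (1 * (\<Sum>\<sigma>\<in>{0..<p^m}. F m \<sigma> x) ^ crit k))"
    unfolding av_def
  proof (rule avg_mono[OF Q0])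
    show "F 0 0 x ^ crit k \<le> P ^ crit k * (1 * (\<Sum>\<sigma>\<in>{0..<p^m}. F m \<sigma> x) ^ crit k)" for x
      using power_mono[OF le[of x] F0, of "crit k"] by (simp add: power_mult_distrib)
  qed
  also have "\<dots> = P ^ crit k * av (\<lambda>x. 1 * (\<Sum>\<sigma>\<in>{0..<p^m}. F m \<sigma> x) ^ crit k)"
    unfolding av_def by (rule avg_cmult)
  also have "\<dots> \<le> P ^ crit k * (\<Sum>\<sigma>\<in>{0..<p^m}. S m \<sigma>) ^ crit k"
    unfolding av_def
  proof (intro mult_left_mono avg_minkowski[OF Q0 _ crit_pos[OF k1]])
    show "avg k (p ^ (k * m)) (\<lambda>x. 1 * F m \<sigma> x ^ crit k) \<le> S m \<sigma> ^ crit k" for \<sigma>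
      using av_leaf[of \<sigma>] by (simp add: av_def)
  qed (use P0 in auto)
  also have "(\<Sum>\<sigma>\<in>{0..<p^m}. S m \<sigma>) = S 0 0" using sum_S[of 0 m 0] by simp
  finally show ?thesis by (simp add: P_def power_mult)
qed

end

section \<open>Orthogonality\<close>

lemma add_char_sum: "add_char Q (sum f A) = (\<Prod>i\<in>A. add_char Q (f i))"
  by (induction A rule: infinite_finite_induct) (simp_all add: add_char_add, simp_all add: add_char_def)

lemma cnj_add_char: "cnj (add_char Q z) = add_char Q (- z)"
  by (simp add: add_char_def cis_cnj)

lemma sum_add_char:
  assumes Q: "Q > 0"
  shows "(\<Sum>x\<in>{0..<Q}. add_char Q (x * c)) = (if Q dvd c then of_int Q else 0)"
proof (cases "Q dvd c")
  case True
  have "add_char Q (x * c) = 1" for x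
    using add_char_cong[of Q "x * c" 0] True by (simp add: add_char_def[of _ 0])
  then show ?thesis using True Q by simp
next
  case False
  define w where "w = add_char Q c"
  have pw: "add_char Q (int n * c) = w ^ n" for n
    by (induction n) (simp_all add: w_def distrib_right add_char_add, simp add: add_char_def)
  have "w \<noteq> 1"
  proof
    assume "w = 1"
    then have "Re w = 1" by simp
    then have "cos (2 * pi * real_of_int c / real_of_int Q) = 1" by (simp add: w_def add_char_def)
    then obtain n :: int where "2 * pi * real_of_int c / real_of_int Q = real_of_int n * 2 * pi"
      unfolding cos_one_2pi_int by blast
    then have "real_of_int c = real_of_int (n * Q)" using Q by (simp add: field_simps)
    then have "c = n * Q" by (simp only: of_int_eq_iff)
    then show False using False by simp
  qed
  have "{0..<Q} = int ` {..<nat Q}" using Q by (simp add: image_int_atLeastLessThan[of 0, simplified] lessThan_atLeast0)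
  then have "(\<Sum>x\<in>{0..<Q}. add_char Q (x * c)) = (\<Sum>n<nat Q. w ^ n)"
    by (simp add: sum.reindex pw)
  also have "\<dots> = (w ^ nat Q - 1) / (w - 1)" by (rule geometric_sum[OF \<open>w \<noteq> 1\<close>])
  also have "w ^ nat Q = 1"
    using pw[of "nat Q"] add_char_cong[of Q "Q * c" 0] Q by (simp add: add_char_def[of _ 0])
  finally show ?thesis using False by simp
qed

lemma torus_orthogonality:
  assumes Q: "Q > 0"
  shows "(\<Sum>x\<in>torus k Q. add_char Q (\<Sum>j=1..k. x j * c j)) = (if \<forall>j\<in>{1..k}. Q dvd c j then of_int Q ^ k else 0)"
proof -
  have "(\<Sum>x\<in>torus k Q. add_char Q (\<Sum>j=1..k. x j * c j)) = (\<Prod>j\<in>{1..k}. \<Sum>y\<in>{0..<Q}. add_char Q (y * c j))"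
    unfolding torus_def add_char_sum by (rule prod_sum_PiE[symmetric]) auto
  also have "\<dots> = (\<Prod>j\<in>{1..k}. if Q dvd c j then of_int Q else 0)"
    by (simp add: sum_add_char[OF Q])
  also have "\<dots> = (if \<forall>j\<in>{1..k}. Q dvd c j then of_int Q ^ k else 0)"
    by auto
  finally show ?thesis .
qed

text \<open>The index set is arbitrary so that the identity serves both for single integers, in
  \<open>dec_one\<close>, and for tuples, in \<open>J_le_avg\<close>.\<close>

lemma avg_parseval:
  assumes Q: "Q > 0"
  shows "avg k Q (\<lambda>x. (cmod (\<Sum>z\<in>Z. \<beta> z * add_char Q (\<Sum>j=1..k. x j * g j z)))\<^sup>2) =
    Re (\<Sum>z\<in>Z. \<Sum>z'\<in>Z. if \<forall>j\<in>{1..k}. Q dvd g j z - g j z' then \<beta> z * cnj (\<beta> z') else 0)"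
proof -
  define w where "w = (\<lambda>x. \<Sum>z\<in>Z. \<beta> z * add_char Q (\<Sum>j=1..k. x j * g j z))"
  have "of_real (\<Sum>x\<in>torus k Q. (cmod (w x))\<^sup>2) = (\<Sum>x\<in>torus k Q. w x * cnj (w x))"
    by (simp only: of_real_sum complex_norm_square)
  also have "\<dots> = (\<Sum>x\<in>torus k Q. \<Sum>z\<in>Z. \<Sum>z'\<in>Z. \<beta> z * cnj (\<beta> z') * add_char Q (\<Sum>j=1..k. x j * (g j z - g j z')))"
  proof (intro sum.cong refl)
    fix x
    have "add_char Q (\<Sum>j=1..k. x j * (g j z - g j z')) =
      add_char Q (\<Sum>j=1..k. x j * g j z) * cnj (add_char Q (\<Sum>j=1..k. x j * g j z'))" for z z'
      unfolding cnj_add_char add_char_add[symmetric] by (simp add: right_diff_distrib sum_subtractf)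
    then show "w x * cnj (w x) = (\<Sum>z\<in>Z. \<Sum>z'\<in>Z. \<beta> z * cnj (\<beta> z') * add_char Q (\<Sum>j=1..k. x j * (g j z - g j z')))"
      by (simp add: w_def sum_product mult_ac)
  qed
  also have "\<dots> = (\<Sum>z\<in>Z. \<Sum>z'\<in>Z. \<beta> z * cnj (\<beta> z') * (\<Sum>x\<in>torus k Q. add_char Q (\<Sum>j=1..k. x j * (g j z - g j z'))))"
    unfolding sum_distrib_left
    by (subst sum.swap, rule sum.cong[OF refl], subst sum.swap, rule refl)
  also have "\<dots> = (\<Sum>z\<in>Z. \<Sum>z'\<in>Z. of_int Q ^ k * (if \<forall>j\<in>{1..k}. Q dvd g j z - g j z' then \<beta> z * cnj (\<beta> z') else 0))"
    unfolding torus_orthogonality[OF Q] by (intro sum.cong refl) auto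
  also have "\<dots> = of_real (real_of_int Q ^ k) * (\<Sum>z\<in>Z. \<Sum>z'\<in>Z. if \<forall>j\<in>{1..k}. Q dvd g j z - g j z' then \<beta> z * cnj (\<beta> z') else 0)"
    by (simp add: sum_distrib_left)
  finally have "Re (of_real (\<Sum>x\<in>torus k Q. (cmod (w x))\<^sup>2)) =
    Re (of_real (real_of_int Q ^ k) * (\<Sum>z\<in>Z. \<Sum>z'\<in>Z. if \<forall>j\<in>{1..k}. Q dvd g j z - g j z' then \<beta> z * cnj (\<beta> z') else 0))"
    by (rule arg_cong)
  then have "(\<Sum>x\<in>torus k Q. (cmod (w x))\<^sup>2) = real_of_int Q ^ k *
    Re (\<Sum>z\<in>Z. \<Sum>z'\<in>Z. if \<forall>j\<in>{1..k}. Q dvd g j z - g j z' then \<beta> z * cnj (\<beta> z') else 0)"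
    by (simp only: times_complex.sel Re_complex_of_real Im_complex_of_real mult_zero_left diff_zero)
  then show ?thesis using Q by (simp add: avg_def w_def)
qed

text \<open>Since n - n' divides q(n) - q(n') for every integer polynomial q, the difference of
  values is n - n' times some 1 + p y, which is prime to \<open>p\<close>: a one-dimensional curve
  is a p-adic isometry.\<close>

lemma curve_one_dvd_iff:
  assumes p: "prime p" and \<gamma>: "curve p 1 \<gamma>"
  shows "p ^ m dvd poly (\<gamma> 1) n - poly (\<gamma> 1) n' \<longleftrightarrow> p ^ m dvd n - n'"
proof -
  have "[:p:] dvd \<gamma> 1 - monom 1 1" using \<gamma> by (simp add: curve_def)
  then obtain q where "\<gamma> 1 - monom 1 1 = [:p:] * q" by (elim dvdE)
  then have "\<gamma> 1 = monom 1 1 + [:p:] * q" by (simp add: algebra_simps)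
  then have po: "poly (\<gamma> 1) z = z + p * poly q z" for z by (simp add: poly_monom)
  have "n - n' dvd poly q n - poly q n'"
  proof -
    have "[:- n', 1:] dvd q - [:poly q n':]" by (simp add: poly_eq_0_iff_dvd[symmetric])
    then obtain h where "q - [:poly q n':] = [:- n', 1:] * h" by (elim dvdE)
    then have "poly (q - [:poly q n':]) n = poly ([:- n', 1:] * h) n" by simp
    then have "poly q n - poly q n' = (n - n') * poly h n" by (simp add: left_diff_distrib)
    then show ?thesis by simp
  qed
  then obtain y where y: "poly q n - poly q n' = (n - n') * y" by (elim dvdE)
  have "poly (\<gamma> 1) n - poly (\<gamma> 1) n' = (n - n') + p * (poly q n - poly q n')"
    unfolding po by (simp add: algebra_simps)
  then have eq: "poly (\<gamma> 1) n - poly (\<gamma> 1) n' = (n - n') * (1 + p * y)"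
    unfolding y by (simp add: algebra_simps)
  have "\<not> p dvd 1 + p * y"
  proof
    assume "p dvd 1 + p * y"
    then have "p dvd 1 + p * y - p * y" by (rule dvd_diff) simp
    then show False using p not_prime_unit[of p] by simp
  qed
  then have "coprime p (1 + p * y)" using p by (simp add: prime_imp_coprime)
  then have "coprime (p ^ m) (1 + p * y)" by (rule coprime_power_left_iff[THEN iffD2, OF disjI1])
  then show ?thesis unfolding eq by (simp add: coprime_dvd_mult_left_iff)
qed

text \<open>As \<open>crit 1 = 1\<close>, the means are of L^2 type, and by
  \<open>curve_one_dvd_iff\<close> the sums over different classes modulo p^m are
  orthogonal.\<close>

lemma dec_one:
  assumes p: "prime p"
  shows "dec p 1 m 1"
  unfolding dec_def
proof (intro allI impI)
  fix \<gamma> \<alpha> and N :: "int set" and d :: "int \<Rightarrow> real"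
  define Q where "Q = p ^ m"
  assume \<gamma>: "curve p 1 \<gamma>" and N: "finite N"
  assume d: "\<forall>\<rho>\<in>{0..<p^m}. 0 \<le> d \<rho> \<and> avg 1 (p ^ (1 * m)) (\<lambda>x. energy 1 (p ^ (1 * m)) \<gamma> \<alpha> (cls p m \<rho> N) x ^ crit 1) \<le> d \<rho> ^ crit 1"
  have p0: "p > 0" using p by (simp add: prime_gt_0_int)
  have Q0: "Q > 0" using p0 by (simp add: Q_def)
  have c1: "crit 1 = 1" by (simp add: crit_def)
  define f where "f = (\<lambda>n n'. if Q dvd n - n' then \<alpha> n * cnj (\<alpha> n') else 0)"
  have av: "avg 1 Q (energy 1 Q \<gamma> \<alpha> T) = Re (\<Sum>n\<in>T. \<Sum>n'\<in>T. f n n')" for T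
    unfolding energy_def expsum_def avg_parseval[OF Q0]
    using curve_one_dvd_iff[OF p \<gamma>, of m] by (simp add: Q_def f_def)
  have "(\<Sum>n\<in>N. \<Sum>n'\<in>N. f n n') = (\<Sum>\<sigma>\<in>{0..<p^m}. \<Sum>n\<in>cls p m \<sigma> N. \<Sum>n'\<in>N. f n n')"
    using sum_cls[OF p0 le0 N, where c = m and t = 0 and f = "\<lambda>n. \<Sum>n'\<in>N. f n n'"] by simp
  also have "\<dots> = (\<Sum>\<sigma>\<in>{0..<p^m}. \<Sum>n\<in>cls p m \<sigma> N. \<Sum>n'\<in>cls p m \<sigma> N. f n n')"
  proof (rule sum.cong[OF refl], rule sum.cong[OF refl], rule sum.mono_neutral_right)
    fix \<sigma> n assume n: "n \<in> cls p m \<sigma> N"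
    show "\<forall>n'\<in>N - cls p m \<sigma> N. f n n' = 0"
    proof
      fix n' assume n': "n' \<in> N - cls p m \<sigma> N"
      have "\<not> p ^ m dvd n - n'"
      proof
        assume "p ^ m dvd n - n'"
        moreover have "p ^ m dvd n - \<sigma>" using n by (simp add: cls_def)
        ultimately have "p ^ m dvd (n - \<sigma>) - (n - n')" using dvd_diff by blast
        then show False using n' by (simp add: cls_def)
      qed
      then show "f n n' = 0" by (simp add: f_def Q_def)
    qed
  qed (use N in \<open>auto simp: cls_def\<close>)
  finally have "avg 1 Q (energy 1 Q \<gamma> \<alpha> N) = (\<Sum>\<sigma>\<in>{0..<p^m}. avg 1 Q (energy 1 Q \<gamma> \<alpha> (cls p m \<sigma> N)))"
    unfolding av by simp
  also have "\<dots> \<le> (\<Sum>\<sigma>\<in>{0..<p^m}. d \<sigma>)"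
    using d by (intro sum_mono) (simp add: c1[unfolded One_nat_def] Q_def)
  finally show "avg 1 (p ^ (1 * m)) (\<lambda>x. energy 1 (p ^ (1 * m)) \<gamma> \<alpha> N x ^ crit 1) \<le> 1 * (\<Sum>\<rho>\<in>{0..<p^m}. d \<rho>) ^ crit 1"
    by (simp add: c1[unfolded One_nat_def] Q_def)
qed

section \<open>Improving the decoupling exponent\<close>

lemma dec_mono:
  assumes dec: "dec p k m K" and "K \<le> K'"
  shows "dec p k m K'"
  unfolding dec_def
proof (intro allI impI)
  fix \<gamma> \<alpha> and N :: "int set" and d :: "int \<Rightarrow> real"
  assume "curve p k \<gamma>" "finite N" and d: "\<forall>\<rho>\<in>{0..<p^m}. 0 \<le> d \<rho> \<and>
    avg k (p ^ (k * m)) (\<lambda>x. energy k (p ^ (k * m)) \<gamma> \<alpha> (cls p m \<rho> N) x ^ crit k) \<le> d \<rho> ^ crit k"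
  then have "avg k (p ^ (k * m)) (\<lambda>x. energy k (p ^ (k * m)) \<gamma> \<alpha> N x ^ crit k) \<le> K * (\<Sum>\<rho>\<in>{0..<p^m}. d \<rho>) ^ crit k"
    using dec unfolding dec_def by blast
  also have "\<dots> \<le> K' * (\<Sum>\<rho>\<in>{0..<p^m}. d \<rho>) ^ crit k"
    using d by (intro mult_right_mono \<open>K \<le> K'\<close> zero_le_power sum_nonneg) blast
  finally show "avg k (p ^ (k * m)) (\<lambda>x. energy k (p ^ (k * m)) \<gamma> \<alpha> N x ^ crit k) \<le> K' * (\<Sum>\<rho>\<in>{0..<p^m}. d \<rho>) ^ crit k" .
qed

lemma decI:
  assumes "prime p" "int k < p" "1 \<le> k"
    and le: "\<And>\<gamma> N \<alpha> d. expsum_data p k m \<gamma> N \<alpha> d \<Longrightarrow>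
      expsum_data.av p k m (\<lambda>x. expsum_data.F p k m \<gamma> N \<alpha> 0 0 x ^ crit k) \<le> K * expsum_data.S p m d 0 0 ^ crit k"
  shows "dec p k m K"
  unfolding dec_def
proof (intro allI impI)
  fix \<gamma> \<alpha> and N :: "int set" and d :: "int \<Rightarrow> real"
  assume "curve p k \<gamma>" "finite N" "\<forall>\<rho>\<in>{0..<p^m}. 0 \<le> d \<rho> \<and>
    avg k (p ^ (k * m)) (\<lambda>x. energy k (p ^ (k * m)) \<gamma> \<alpha> (cls p m \<rho> N) x ^ crit k) \<le> d \<rho> ^ crit k"
  then interpret expsum_data p k m \<gamma> N \<alpha> d
    using assms(1-3) by unfold_locales auto
  show "avg k (p ^ (k * m)) (\<lambda>x. energy k (p ^ (k * m)) \<gamma> \<alpha> N x ^ crit k) \<le> K * (\<Sum>\<rho>\<in>{0..<p^m}. d \<rho>) ^ crit k"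
    using le[OF expsum_data_axioms] by (simp add: av_def F_def S_def)
qed

text \<open>\<open>\<eta>\<close> is an admissible growth exponent in terms of the scale p^m;
  \<open>C\<close> may depend on everything but \<open>m\<close>.\<close>

definition dec_exp :: "int \<Rightarrow> nat \<Rightarrow> real \<Rightarrow> bool" where
  "dec_exp p k \<eta> \<longleftrightarrow> (\<exists>C>0. \<forall>m. dec p k m (C * real_of_int p powr (\<eta> * real m)))"

lemma dec_exp_mono:
  assumes "prime p" "dec_exp p k \<eta>" "\<eta> \<le> \<eta>'"
  shows "dec_exp p k \<eta>'"
proof -
  have p: "real_of_int p > 1" using assms(1) by (simp add: prime_gt_1_int)
  from assms obtain C where C: "C > 0" "\<And>m. dec p k m (C * real_of_int p powr (\<eta> * real m))"
    unfolding dec_exp_def by blast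
  have "dec p k m (C * real_of_int p powr (\<eta>' * real m))" for m
    by (rule dec_mono[OF C(2)]) (use C p assms in \<open>auto intro!: mult_left_mono powr_mono mult_right_mono\<close>)
  then show ?thesis using C unfolding dec_exp_def by blast
qed

lemma dec_trivial:
  assumes "prime p" "int k < p" "1 \<le> k"
  shows "dec p k m (real_of_int p ^ (m * crit k))"
  by (rule decI[OF assms]) (rule expsum_data.av_trivial)

lemma dec_exp_trivial:
  assumes "prime p" "int k < p" "1 \<le> k"
  shows "dec_exp p k (real (crit k))"
proof -
  have p: "real_of_int p > 1" using assms(1) by (simp add: prime_gt_1_int)
  have "real_of_int p ^ (m * crit k) = 1 * real_of_int p powr (real (crit k) * real m)" for m
    using p by (simp add: powr_realpow[symmetric] mult.commute)
  then show ?thesis using dec_trivial[OF assms] unfolding dec_exp_def by (intro exI[of _ 1]) auto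
qed

text \<open>\<open>gain k \<eta> n l * b\<close> is the exponent of \<open>p\<close> saved over the trivial bound in the \<open>l\<close>-th bilinear
  estimate at scale \<open>b\<close> after \<open>n\<close> rounds; the recursion mirrors \<open>bil_holder\<close> at \<open>c = (k - l + 1) * b / l\<close>.\<close>

fun gain :: "nat \<Rightarrow> real \<Rightarrow> nat \<Rightarrow> nat \<Rightarrow> real" where
  "gain k \<eta> 0 l = (if l = 0 then \<eta> else 0)"
| "gain k \<eta> (Suc n) l = (if l = 0 then \<eta> else
     gain k \<eta> n (k - l) / real l + real (k - l) / real (k - l + 1) * gain k \<eta> n (l - 1))"

lemma gain_0 [simp]: "gain k \<eta> n 0 = \<eta>"
  by (cases n) auto

text \<open>A conservation law: in one round the gain of index \<open>l\<close> splits into the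
  fraction 1 / (k - l), which goes to index \<open>k - l\<close>, and the fraction (k - l - 1) / (k
  - l), which goes to index \<open>l + 1\<close>. The only supply is index 0, which keeps its value
  and sends (k - 1) / k of it to index 1.\<close>

lemma sum_gain_Suc:
  assumes k: "2 \<le> k"
  shows "(\<Sum>l=1..k-1. gain k \<eta> (Suc n) l) = (\<Sum>l=1..k-1. gain k \<eta> n l) + real (k - 1) / real k * \<eta>"
proof -
  define g where "g = gain k \<eta> n"
  obtain j where j: "k = Suc (Suc j)" using k by (metis Suc_le_D numeral_2_eq_2 Suc_le_mono)
  have "(\<Sum>l=1..k-1. gain k \<eta> (Suc n) l) =
      (\<Sum>l=1..k-1. g (k - l) / real l) + (\<Sum>l=1..k-1. real (k - l) / real (k - l + 1) * g (l - 1))"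
    unfolding sum.distrib[symmetric] by (intro sum.cong) (auto simp: g_def)
  also have "(\<Sum>l=1..k-1. g (k - l) / real l) = (\<Sum>l=1..k-1. g l / real (k - l))"
    by (rule sum.reindex_bij_witness[of _ "\<lambda>l. k - l" "\<lambda>l. k - l"]) (use k in auto)
  also have "(\<Sum>l=1..k-1. real (k - l) / real (k - l + 1) * g (l - 1)) = (\<Sum>l=0..k-2. real (k - Suc l) / real (k - l) * g l)"
    by (rule sum.reindex_bij_witness[of _ Suc "\<lambda>l. l - 1"]) (use k in \<open>auto simp: Suc_diff_Suc\<close>)
  \<comment> \<open>The added term \<open>l = k - 1\<close> has coefficient 0: nothing flows on to
    index \<open>k\<close>.\<close>
  also have "\<dots> = (\<Sum>l=0..k-1. real (k - Suc l) / real (k - l) * g l)"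
    by (rule sum.mono_neutral_left) (auto simp: j)
  also have "\<dots> = real (k - 1) / real k * \<eta> + (\<Sum>l=1..k-1. real (k - Suc l) / real (k - l) * g l)"
    by (subst sum.atLeast_Suc_atMost) (auto simp: g_def)
  also have "(\<Sum>l=1..k-1. g l / real (k - l)) + (real (k - 1) / real k * \<eta> + (\<Sum>l=1..k-1. real (k - Suc l) / real (k - l) * g l))
     = (\<Sum>l=1..k-1. g l / real (k - l) + real (k - Suc l) / real (k - l) * g l) + real (k - 1) / real k * \<eta>"
    by (simp add: sum.distrib)
  also have "(\<Sum>l=1..k-1. g l / real (k - l) + real (k - Suc l) / real (k - l) * g l) = (\<Sum>l=1..k-1. g l)"
  proof (intro sum.cong refl)
    fix l assume "l \<in> {1..k-1}"
    then have "real (k - l) = 1 + real (k - Suc l)" "real (k - l) > 0" by (auto simp: of_nat_diff)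
    moreover have "g l / real (k - l) + real (k - Suc l) / real (k - l) * g l = (1 + real (k - Suc l)) / real (k - l) * g l"
      by (simp add: add_divide_distrib distrib_right)
    ultimately show "g l / real (k - l) + real (k - Suc l) / real (k - l) * g l = g l" by simp
  qed
  finally show ?thesis by (simp add: g_def)
qed

text \<open>The gains start at 0 and their sum grows by (k - 1) / k times \<open>\<eta>\<close> per
  round, so one of the k - 1 indices reaches the average.\<close>

lemma gain_unbounded:
  assumes k: "2 \<le> k"
  shows "\<exists>l\<in>{1..k-1}. gain k \<eta> n l \<ge> real n * \<eta> / real k"
proof (rule ccontr)
  assume "\<not> ?thesis"
  then have "(\<Sum>l=1..k-1. gain k \<eta> n l) < (\<Sum>l=1..k-1. real n * \<eta> / real k)"
    using k by (intro sum_strict_mono) (auto simp: not_le)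
  moreover have "(\<Sum>l=1..k-1. gain k \<eta> n l) = real n * (real (k - 1) / real k * \<eta>)"
  proof (induction n)
    case (Suc n)
    then show ?case unfolding sum_gain_Suc[OF k] by (simp add: algebra_simps add_divide_distrib)
  qed simp
  ultimately show False by (simp add: mult_ac)
qed

text \<open>The factor \<open>fact k ^ n\<close> of \<open>b\<close> keeps the scales \<open>(k - l + 1) * b / l\<close> of all \<open>n\<close> rounds integral.\<close>

lemma bil_bound:
  fixes p :: int
  assumes p: "prime p" and kp: "int k < p" and k: "2 \<le> k"
    and IH: "\<And>l. 1 \<le> l \<Longrightarrow> l < k \<Longrightarrow> dec_exp p l \<epsilon>"
    and \<eta>: "dec_exp p k \<eta>" "\<eta>0 \<le> \<eta>" "0 < \<eta>0" and \<epsilon>: "\<epsilon> > 0"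
  shows "\<exists>C>0. \<forall>m \<gamma> N \<alpha> d l a b. expsum_data p k m \<gamma> N \<alpha> d \<longrightarrow> 1 \<le> l \<longrightarrow> l < k \<longrightarrow>
     fact k ^ n dvd b \<longrightarrow> 1 \<le> b \<longrightarrow> k ^ (n + 1) * b \<le> m \<longrightarrow> 1 \<le> a \<longrightarrow> l * a \<le> b * (k - l + 1) \<longrightarrow>
     expsum_data.bil p k m \<gamma> N \<alpha> d l a b
       (C * real_of_int p powr (\<eta> * m + n * \<epsilon> * m - gain k \<eta>0 n l * b))"
proof (induction n)
  case 0
  have p1: "real_of_int p > 1" using p by (simp add: prime_gt_1_int)
  from \<eta> obtain C where C: "C > 0" "\<And>m. dec p k m (C * real_of_int p powr (\<eta> * real m))"
    unfolding dec_exp_def by blast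
  show ?case
  proof (intro exI[of _ C] conjI C allI impI)
    fix m \<gamma> N \<alpha> d l a b
    assume "expsum_data p k m \<gamma> N \<alpha> d" and l: "1 \<le> l" "l < k" and b: "1 \<le> b" "k ^ (0 + 1) * b \<le> m"
      and a: "1 \<le> a" "l * a \<le> b * (k - l + 1)"
    then interpret expsum_data p k m \<gamma> N \<alpha> d by simp
    have "a \<le> l * a" using l by simp
    also have "\<dots> \<le> b * k" using a l mult_le_mono2[of "k - l + 1" k b] by linarith
    finally have am: "a \<le> m" using b by (simp add: mult.commute)
    have "b \<le> k * b" using k by simp
    also have "k * b \<le> m" using b by simp
    finally have bm: "b \<le> m" .
    have d: "dec p k (m - c) (C * real_of_int p powr (\<eta> * m))" for c
      by (rule dec_mono[OF C(2)]) (use C p1 \<eta> in \<open>auto intro!: mult_left_mono powr_mono\<close>)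
    have "bil l a b (C * real_of_int p powr (\<eta> * m))"
      by (rule bil_base[OF l a(1) am d b(1) bm d]) (use C in auto)
    then show "bil l a b (C * real_of_int p powr (\<eta> * m + real 0 * \<epsilon> * m - gain k \<eta>0 0 l * b))"
      using l by simp
  qed
next
  case (Suc n)
  have p1: "real_of_int p > 1" using p by (simp add: prime_gt_1_int)
  from Suc obtain C1 where C1: "C1 > 0" and b1: "\<And>m \<gamma> N \<alpha> d l a b. expsum_data p k m \<gamma> N \<alpha> d \<Longrightarrow> 1 \<le> l \<Longrightarrow> l < k \<Longrightarrow>
     fact k ^ n dvd b \<Longrightarrow> 1 \<le> b \<Longrightarrow> k ^ (n + 1) * b \<le> m \<Longrightarrow> 1 \<le> a \<Longrightarrow> l * a \<le> b * (k - l + 1) \<Longrightarrow>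
     expsum_data.bil p k m \<gamma> N \<alpha> d l a b
       (C1 * real_of_int p powr (\<eta> * m + n * \<epsilon> * m - gain k \<eta>0 n l * b))" by blast
  from \<eta> obtain C0 where C0: "C0 > 0" "\<And>m. dec p k m (C0 * real_of_int p powr (\<eta> * real m))"
    unfolding dec_exp_def by blast
  have "\<forall>l\<in>{1..<k}. \<exists>C>0. \<forall>m. dec p l m (C * real_of_int p powr (\<epsilon> * real m))"
    using IH unfolding dec_exp_def by simp
  from bchoice[OF this] obtain D where D: "\<And>l. l \<in> {1..<k} \<Longrightarrow> D l > 0"
    "\<And>l m. l \<in> {1..<k} \<Longrightarrow> dec p l m (D l * real_of_int p powr (\<epsilon> * real m))" by blast
  define E where "E = 1 + (\<Sum>l\<in>{1..<k}. D l)"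
  have DE: "D l \<le> E" if "l \<in> {1..<k}" for l
    using member_le_sum[of l "{1..<k}" D] D that unfolding E_def by (simp add: less_imp_le)
  have E0: "E > 0" unfolding E_def using D by (intro add_pos_nonneg sum_nonneg) (auto simp: less_imp_le)
  define A where "A = max C1 C0"
  have A: "A > 0" "C1 \<le> A" "C0 \<le> A" using C1 by (auto simp: A_def)
  show ?case
  proof (intro exI[of _ "E * A"] conjI allI impI)
    show "E * A > 0" using E0 A by simp
    fix m \<gamma> N \<alpha> d l a b
    assume "expsum_data p k m \<gamma> N \<alpha> d" and l: "1 \<le> l" "l < k" and dv: "fact k ^ Suc n dvd b" and b: "1 \<le> b" "k ^ (Suc n + 1) * b \<le> m"
      and a: "1 \<le> a" "l * a \<le> b * (k - l + 1)"
    then interpret expsum_data p k m \<gamma> N \<alpha> d by simp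
    have lf: "l dvd fact k" using l by (intro dvd_fact) auto
    obtain x where x: "b = fact k ^ n * fact k * x" using dv by (auto elim!: dvdE simp: mult_ac)
    obtain y where y: "fact k = l * y" using lf by (elim dvdE)
    define c where "c = fact k ^ n * y * x * (k - l + 1)"
    have lc: "l * c = b * (k - l + 1)" unfolding c_def x y by (simp only: mult_ac)
    have cn: "fact k ^ n dvd c" unfolding c_def by (simp add: mult.assoc)
    have bn: "fact k ^ n dvd b" unfolding x by (simp add: mult.assoc)
    have c1: "1 \<le> c" using lc b l by (cases c) auto
    have ac: "a \<le> c" using a(2) l unfolding lc[symmetric] by simp
    \<comment> \<open>Each round enlarges the scale at most \<open>k\<close> times; the extra factor
      \<open>k\<close> in the hypothesis on \<open>b\<close> keeps \<open>c\<close> within the range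
      of the induction hypothesis.\<close>
    have ck: "c \<le> k * b"
    proof -
      have "c \<le> l * c" using l by simp
      also have "\<dots> \<le> b * k" unfolding lc using l by (intro mult_le_mono2) auto
      finally show ?thesis by (simp add: mult.commute)
    qed
    have kc: "k ^ (n + 1) * c \<le> m"
    proof -
      have "k ^ (n + 1) * c \<le> k ^ (n + 1) * (k * b)" using ck by (rule mult_le_mono2)
      also have "\<dots> = k ^ (Suc n + 1) * b" by simp
      also note b(2)
      finally show ?thesis .
    qed
    have kb: "k ^ (n + 1) * b \<le> m"
    proof -
      have "k ^ (n + 1) * b \<le> k * (k ^ (n + 1) * b)" using k by simp
      also have "\<dots> \<le> m" using b by (simp add: mult.assoc)
      finally show ?thesis .
    qed
    have kn: "1 \<le> k ^ (n + 1)" using k by simp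
    have cm: "c \<le> m" using kc mult_le_mono1[OF kn, of c] by linarith
    have bm: "b \<le> m" using kb mult_le_mono1[OF kn, of b] by linarith
    let ?q = "k - l"
    let ?P = "real_of_int p"
    let ?u = "\<eta> * m + n * \<epsilon> * m - gain k \<eta>0 n ?q * c"
    let ?v = "\<eta> * m + n * \<epsilon> * m - gain k \<eta>0 n (l - 1) * b"
    \<comment> \<open>The classes have changed roles, so the gain of index \<open>k - l\<close>
      counts at the scale \<open>c\<close>.\<close>
    have B1: "bil ?q b c (A * ?P powr ?u)"
    proof (rule bil_mono[OF b1[OF expsum_data_axioms]])
      show "(k - l) * b \<le> c * (k - (k - l) + 1)"
      proof -
        have "l * ((k - l) * b) \<le> (l + 1) * (b * (k - l + 1))"
          by (simp add: algebra_simps)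
        also have "\<dots> = l * (c * (k - (k - l) + 1))" using l unfolding lc[symmetric] by (simp add: algebra_simps)
        finally show ?thesis using l by simp
      qed
    qed (use l cn c1 kc b A in \<open>auto intro: mult_right_mono\<close>)
    \<comment> \<open>For l = 1 this is index 0, outside the induction hypothesis. There the saving
      comes from rescaling: m - b scales cost \<open>\<eta> * b\<close> less, which is at least
      \<open>\<eta>0 * b\<close>.\<close>
    have B2: "bil (l - 1) c b (A * ?P powr ?v)"
    proof (cases "l = 1")
      case True
      have "bil 0 c b (A * ?P powr ?v)"
      proof (rule bil_zero[OF b(1) bm dec_mono[OF C0(2)]])
        have "real (m - b) = real m - real b" using bm by simp
        moreover have "\<eta>0 * real b \<le> \<eta> * real b" using \<eta> by (intro mult_right_mono) auto
        moreover have "0 \<le> n * \<epsilon> * m" using \<epsilon> by simp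
        ultimately have "\<eta> * real (m - b) \<le> ?v" using True by (simp add: right_diff_distrib)
        then show "C0 * ?P powr (\<eta> * real (m - b)) \<le> A * ?P powr ?v"
          using A p1 C0 by (intro mult_mono powr_mono) auto
      qed (use A in simp)
      then show ?thesis using True by simp
    next
      case False
      show ?thesis
      proof (rule bil_mono[OF b1[OF expsum_data_axioms]])
        show "(l - 1) * c \<le> b * (k - (l - 1) + 1)"
        proof -
          have "l * ((l - 1) * c) = (l - 1) * (b * (k - l + 1))" unfolding lc[symmetric] by (simp only: mult_ac)
          also have "\<dots> \<le> l * (b * (k - (l - 1) + 1))" by (intro mult_le_mono) auto
          finally show ?thesis using l by simp
        qed
      qed (use False l bn b kb c1 A in \<open>auto intro: mult_right_mono\<close>)
    qed
    define M where "M = A * ?P powr ((?u + real ?q * ?v) / real (1 + ?q))"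
    have M0: "M \<ge> 0" using A by (simp add: M_def)
    have "bil l c b M"
    proof (rule bil_holder[OF l B1 _ B2 _ M0])
      have "(?P powr ((?u + real ?q * ?v) / real (1 + ?q))) ^ (1 + ?q) = ?P powr (?u + real ?q * ?v)"
        using p1 by (subst powr_realpow[symmetric]) (auto simp: powr_powr)
      also have "\<dots> = ?P powr ?u * (?P powr ?v) ^ ?q"
        using p1 by (subst powr_realpow[symmetric]) (auto simp: powr_powr powr_add mult.commute)
      finally show "M ^ (1 + ?q) = A * ?P powr ?u * (A * ?P powr ?v) ^ ?q"
        unfolding M_def power_mult_distrib by simp
    qed (use A in auto)
    from bil_refine[OF l a(1) ac cm _ D(2) _ M0 this] have "bil l a b (D l * ?P powr (\<epsilon> * real (c - a)) * M)"
      using l lc D(1)[of l] by simp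
    then show "bil l a b (E * A * ?P powr (\<eta> * m + real (Suc n) * \<epsilon> * m - gain k \<eta>0 (Suc n) l * b))"
    proof (rule bil_mono)
      have "D l * ?P powr (\<epsilon> * real (c - a)) * M \<le> E * ?P powr (\<epsilon> * real m) * M"
        using DE[of l] l cm p1 \<epsilon> M0 E0 by (intro mult_mono powr_mono) auto
      also have "\<dots> = E * A * ?P powr (\<epsilon> * real m + (?u + real ?q * ?v) / real (1 + ?q))"
        by (simp add: M_def powr_add)
      also have "\<epsilon> * real m + (?u + real ?q * ?v) / real (1 + ?q) = \<eta> * m + real (Suc n) * \<epsilon> * m - gain k \<eta>0 (Suc n) l * b"
      proof -
        have "real l * real c = real b * real (1 + ?q)" unfolding of_nat_mult[symmetric] lc by (simp only: add.commute)
        \<comment> \<open>Hoelder's inequality divides the saving at scale \<open>c\<close> by 1 +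
          q; this identity turns it into the term with 1 / l in the recursion of
          \<open>gain\<close>.\<close>
        then have c: "real c / real (1 + ?q) = real b / real l" using l by (simp add: field_simps)
        define w where "w = \<eta> * m + n * \<epsilon> * m"
        have "(?u + real ?q * ?v) / real (1 + ?q) = w * (1 + real ?q) / real (1 + ?q) - gain k \<eta>0 n ?q * (real c / real (1 + ?q))
            - real ?q / real (1 + ?q) * gain k \<eta>0 n (l - 1) * b"
          unfolding w_def[symmetric] by (simp add: diff_divide_distrib add_divide_distrib algebra_simps)
        also have "w * (1 + real ?q) / real (1 + ?q) = w" by simp
        finally show ?thesis
          using l unfolding c w_def by (simp add: algebra_simps)
      qed
      finally show "D l * ?P powr (\<epsilon> * real (c - a)) * M
        \<le> E * A * ?P powr (\<eta> * m + real (Suc n) * \<epsilon> * m - gain k \<eta>0 (Suc n) l * b)" .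
    qed
  qed
qed

text \<open>In terms of \<open>crit k\<close>-th roots, \<open>av_bilinear\<close> bounds the
  constant for m + 1 by the one for m plus p^2 times the bilinear bound. The bilinear bounds grow
  geometrically, as \<rho> > 0, so their sum is comparable to the last one.\<close>

lemma dec_exp_of_bil:
  assumes p: "prime p" and kp: "int k < p" and l: "l < k" and \<rho>: "\<rho> > 0" and C: "C > 0"
    and bil: "\<And>m \<gamma> N \<alpha> d. 1 \<le> m \<Longrightarrow> expsum_data p k m \<gamma> N \<alpha> d \<Longrightarrow>
       expsum_data.bil p k m \<gamma> N \<alpha> d l 1 1 (C * real_of_int p powr (\<rho> * real m))"
  shows "dec_exp p k \<rho>"
proof -
  have p1: "real_of_int p > 1" using p by (simp add: prime_gt_1_int)
  have k1: "1 \<le> k" using l by simp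
  define r where "r = crit k"
  have r1: "r \<ge> 1" using crit_pos[OF k1] by (simp add: r_def)
  define h where "h = root r C"
  have h: "h ^ r = C" "h > 0" using C r1 by (simp_all add: h_def real_root_gt_zero)
  define P where "P = (\<lambda>m. real_of_int p powr (\<rho> * real m / real r))"
  have P: "P m ^ r = real_of_int p powr (\<rho> * real m)" "P m > 0" for m
    using p1 r1 by (simp_all add: P_def powr_realpow[symmetric] powr_powr)
  define \<theta> where "\<theta> = real_of_int p powr (- (\<rho> / real r))"
  have \<theta>: "0 < \<theta>" "\<theta> < 1" using p1 r1 \<rho> by (auto simp: \<theta>_def intro!: powr_less_one)
  have P\<theta>: "P m = \<theta> * P (Suc m)" for m
    by (simp add: P_def \<theta>_def powr_add[symmetric] add_divide_distrib algebra_simps)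
  \<comment> \<open>Chosen so that \<open>Y * \<theta> + p^2 * h \<le> Y\<close>, which is the
    inductive step; the maximum with 1 covers m = 0.\<close>
  define Y where "Y = max 1 (real_of_int p ^ 2 * h / (1 - \<theta>))"
  have Y: "Y \<ge> 1" "real_of_int p ^ 2 * h \<le> Y * (1 - \<theta>)"
    using \<theta> by (auto simp: Y_def pos_divide_le_eq[symmetric])
  have "dec p k m ((Y * P m) ^ r)" for m
  proof (induction m)
    case 0
    show ?case
      by (rule dec_mono[OF dec_trivial[OF p kp k1]]) (use Y p1 in \<open>simp add: P_def\<close>)
  next
    case (Suc m)
    show ?case
    proof (rule decI[OF p kp k1])
      fix \<gamma> N \<alpha> d
      assume "expsum_data p k (Suc m) \<gamma> N \<alpha> d"
      then interpret expsum_data p k "Suc m" \<gamma> N \<alpha> d .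
      have "av (\<lambda>x. F 0 0 x ^ crit k) \<le> ((Y * P m + real_of_int p ^ 2 * (h * P (Suc m))) * S 0 0) ^ crit k"
      proof (rule av_bilinear[OF _ l])
        have "(h * P (Suc m)) ^ crit k = C * real_of_int p powr (\<rho> * real (Suc m))"
          using h P by (simp add: r_def power_mult_distrib)
        then show "bil l 1 1 ((h * P (Suc m)) ^ crit k)"
          using bil[OF _ expsum_data_axioms] by simp
      qed (use Suc Y h P in \<open>auto simp: r_def less_imp_le\<close>)
      also have "\<dots> \<le> ((Y * P (Suc m)) * S 0 0) ^ crit k"
      proof (intro power_mono mult_right_mono)
        have "Y * P m + real_of_int p ^ 2 * (h * P (Suc m)) = (Y * \<theta> + real_of_int p ^ 2 * h) * P (Suc m)"
          unfolding P\<theta>[of m] by (simp add: algebra_simps)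
        also have "\<dots> \<le> Y * P (Suc m)"
          using Y P(2)[of "Suc m"] by (intro mult_right_mono) (auto simp: algebra_simps)
        finally show "Y * P m + real_of_int p ^ 2 * (h * P (Suc m)) \<le> Y * P (Suc m)" .
      qed (use Y h P in \<open>auto intro!: mult_nonneg_nonneg add_nonneg_nonneg simp: less_imp_le\<close>)
      finally show "av (\<lambda>x. F 0 0 x ^ crit k) \<le> (Y * P (Suc m)) ^ r * S 0 0 ^ crit k"
        by (simp add: r_def power_mult_distrib)
    qed
  qed
  then have "dec p k m (Y ^ r * real_of_int p powr (\<rho> * real m))" for m
    by (simp add: power_mult_distrib P)
  moreover have "Y ^ r > 0" using Y by simp
  ultimately show ?thesis unfolding dec_exp_def by blast
qed

text \<open>The decrement must be the same for all \<open>\<eta> \<ge> \<eta>0\<close>, so that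
  finitely many steps lead down to \<open>\<eta>0\<close>. Hence the gains are computed from
  \<open>\<eta>0\<close>, and the number of rounds does not depend on \<open>\<eta>\<close>.\<close>

lemma dec_exp_improve:
  assumes p: "prime p" and kp: "int k < p" and k: "2 \<le> k"
    and IH: "\<And>l \<epsilon>. 1 \<le> l \<Longrightarrow> l < k \<Longrightarrow> \<epsilon> > 0 \<Longrightarrow> dec_exp p l \<epsilon>" and \<eta>0: "0 < \<eta>0"
  shows "\<exists>\<kappa>>0. \<forall>\<eta>\<ge>\<eta>0. dec_exp p k \<eta> \<longrightarrow> dec_exp p k (\<eta> - \<kappa>)"
proof -
  have p1: "real_of_int p > 1" using p by (simp add: prime_gt_1_int)
  \<comment> \<open>So many rounds that for some index the gain per unit of \<open>b\<close> is at
    least \<open>crit k + 1\<close>: \<open>crit k\<close> pays for \<open>bil_split\<close>, and 1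
    is left.\<close>
  obtain n :: nat where n: "(real (crit k) + 1) * real k / \<eta>0 \<le> real n" using real_arch_simple by blast
  then have n2: "real (crit k) + 1 \<le> real n * \<eta>0 / real k" using \<eta>0 k by (simp add: field_simps)
  have n1: "n \<ge> 1"
  proof (rule ccontr)
    assume "\<not> n \<ge> 1"
    then have "n = 0" by simp
    then show False using n2 by simp
  qed
  obtain l where l: "1 \<le> l" "l < k" and g: "gain k \<eta>0 n l \<ge> real (crit k) + 1"
  proof -
    obtain l where "l \<in> {1..k-1}" "real n * \<eta>0 / real k \<le> gain k \<eta>0 n l"
      using gain_unbounded[OF k, where \<eta> = \<eta>0 and n = n] by blast
    then show ?thesis using n2 k by (intro that[of l]) auto
  qed
  define W :: nat where "W = fact k ^ n"
  define V where "V = k ^ (n + 1)"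
  have W1: "W \<ge> 1" by (simp add: W_def)
  have V1: "V \<ge> 1" using k by (simp add: V_def)
  \<comment> \<open>The surplus is \<open>b\<close>, at least m / (2 V). Half of that bound pays for
    \<open>n\<close> losses of p^(\<epsilon> m), the other half for the decrement; the bound
    \<open>\<eta>0 / 2\<close> keeps \<open>\<eta> - \<kappa>\<close> positive.\<close>
  define \<kappa> where "\<kappa> = min (\<eta>0 / 2) (1 / (4 * real V))"
  have \<kappa>: "\<kappa> > 0" "\<kappa> \<le> \<eta>0 / 2" "\<kappa> \<le> 1 / (4 * real V)" using \<eta>0 V1 by (auto simp: \<kappa>_def)
  define \<epsilon> where "\<epsilon> = 1 / (4 * real V * real n)"
  have \<epsilon>: "\<epsilon> > 0" "real n * \<epsilon> = 1 / (4 * real V)" using V1 n1 by (auto simp: \<epsilon>_def)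
  have "dec_exp p k (\<eta> - \<kappa>)" if \<eta>: "\<eta>0 \<le> \<eta>" "dec_exp p k \<eta>" for \<eta>
  proof -
    have \<eta>pos: "\<eta> > 0" "\<eta> - \<kappa> > 0" using \<eta> \<eta>0 \<kappa> by auto
    obtain C0 where C0: "C0 > 0" "\<And>m. dec p k m (C0 * real_of_int p powr (\<eta> * real m))"
      using \<eta> unfolding dec_exp_def by blast
    obtain C1 where C1: "C1 > 0" and b1: "\<And>m \<gamma> N \<alpha> d b. expsum_data p k m \<gamma> N \<alpha> d \<Longrightarrow>
       W dvd b \<Longrightarrow> 1 \<le> b \<Longrightarrow> V * b \<le> m \<Longrightarrow> l * 1 \<le> b * (k - l + 1) \<Longrightarrow>
       expsum_data.bil p k m \<gamma> N \<alpha> d l 1 b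
       (C1 * real_of_int p powr (\<eta> * m + n * \<epsilon> * m - gain k \<eta>0 n l * b))"
      using bil_bound[OF p kp k IH[OF _ _ \<epsilon>(1)] \<eta>(2,1) \<eta>0 \<epsilon>(1), of n] l unfolding W_def V_def by blast
    \<comment> \<open>For the finitely many m < W V, which leave no room for a multiple
      \<open>b\<close> of \<open>W\<close>, the exponent \<open>\<eta>\<close> is kept and the
      excess p^(\<kappa> m) goes into the constant.\<close>
    define C where "C = max (C0 * real_of_int p powr (\<kappa> * real (W * V))) C1"
    have C: "C > 0" "C1 \<le> C" "C0 * real_of_int p powr (\<kappa> * real (W * V)) \<le> C" using C1 by (auto simp: C_def)
    show ?thesis
    proof (rule dec_exp_of_bil[OF p kp l(2) \<eta>pos(2) C(1)])
      fix m \<gamma> N \<alpha> d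
      assume m: "1 \<le> m" and "expsum_data p k m \<gamma> N \<alpha> d"
      then interpret expsum_data p k m \<gamma> N \<alpha> d by simp
      show "bil l 1 1 (C * real_of_int p powr ((\<eta> - \<kappa>) * real m))"
      proof (cases "m < W * V")
        case True
        have d1: "dec p k (m - 1) (C0 * real_of_int p powr (\<eta> * real m))"
          by (rule dec_mono[OF C0(2)]) (use C0 p1 \<eta>pos in \<open>auto intro!: mult_left_mono powr_mono\<close>)
        have "bil l 1 1 (C0 * real_of_int p powr (\<eta> * real m))"
          by (rule bil_base[OF l le_refl m d1 le_refl m d1]) (use C0 in simp)
        then show ?thesis
        proof (rule bil_mono)
          have "\<kappa> * real m \<le> \<kappa> * real (W * V)" using True \<kappa>(1) by (intro mult_left_mono) linarith+
          then have "C0 * real_of_int p powr (\<eta> * real m) \<le> C0 * real_of_int p powr (\<kappa> * real (W * V) + (\<eta> - \<kappa>) * real m)"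
            using C0 p1 by (intro mult_left_mono powr_mono) (auto simp: algebra_simps)
          also have "\<dots> = C0 * real_of_int p powr (\<kappa> * real (W * V)) * real_of_int p powr ((\<eta> - \<kappa>) * real m)"
            by (simp add: powr_add)
          also have "\<dots> \<le> C * real_of_int p powr ((\<eta> - \<kappa>) * real m)"
            using C by (intro mult_right_mono) auto
          finally show "C0 * real_of_int p powr (\<eta> * real m) \<le> C * real_of_int p powr ((\<eta> - \<kappa>) * real m)" .
        qed
      next
        case False
        \<comment> \<open>\<open>b\<close> becomes the largest multiple of \<open>W\<close> with
          \<open>V * b \<le> m\<close>; as t \<ge> 1, rounding down loses at most a factor
          2.\<close>
        define t where "t = m div (W * V)"
        define b where "b = W * t"
        have WV: "W * V > 0" using W1 V1 by simp
        have t1: "t \<ge> 1" using False WV unfolding t_def by (simp add: Suc_le_eq div_greater_zero_iff)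
        have bW: "W \<le> b" using t1 by (simp add: b_def)
        have b1': "1 \<le> b" using bW W1 by simp
        have "V * b = t * (W * V)" by (simp add: b_def mult_ac)
        also have "\<dots> \<le> m" unfolding t_def by (rule div_times_less_eq_dividend)
        finally have Vb: "V * b \<le> m" .
        have "m < (t + 1) * (W * V)" using dividend_less_div_times[OF WV, of m] unfolding t_def by simp
        also have "\<dots> \<le> (2 * t) * (W * V)" using t1 by (intro mult_le_mono1) simp
        also have "\<dots> = 2 * V * b" by (simp add: b_def mult_ac)
        finally have "real m \<le> real (2 * V * b)" by linarith
        then have bm: "real m * (1 / (2 * real V)) \<le> real b" using V1 by (simp add: field_simps)
        have lb: "l * 1 \<le> b * (k - l + 1)"
        proof -
          have "l \<le> k" using l by simp
          also have "k \<le> fact k" by (rule fact_ge_self)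
          also have "fact k \<le> W" unfolding W_def using n1 by (intro self_le_power) auto
          also have "W \<le> b" by (rule bW)
          also have "b \<le> b * (k - l + 1)" by simp
          finally show ?thesis by simp
        qed
        let ?P = "real_of_int p"
        have "bil l 1 b (C1 * ?P powr (\<eta> * m + n * \<epsilon> * m - gain k \<eta>0 n l * b))"
          by (rule b1[OF expsum_data_axioms _ b1' Vb lb]) (simp add: b_def)
        from bil_split[OF l b1' _ this]
        have "bil l 1 1 (real_of_int (p ^ (b - 1)) ^ (crit k - crit l) * (C1 * ?P powr (\<eta> * m + n * \<epsilon> * m - gain k \<eta>0 n l * b)))"
          using C1 by simp
        then show ?thesis
        proof (rule bil_mono)
          have "real_of_int (p ^ (b - 1)) ^ (crit k - crit l) = ?P powr (real ((b - 1) * (crit k - crit l)))"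
            using p1 by (simp add: powr_realpow power_mult del: of_nat_mult)
          also have "\<dots> \<le> ?P powr (real b * real (crit k))"
          proof (rule powr_mono)
            have "(b - 1) * (crit k - crit l) \<le> b * crit k" by (intro mult_le_mono) auto
            then show "real ((b - 1) * (crit k - crit l)) \<le> real b * real (crit k)"
              by (metis of_nat_le_iff of_nat_mult)
          qed (use p1 in simp)
          finally have 1: "real_of_int (p ^ (b - 1)) ^ (crit k - crit l) \<le> ?P powr (real b * real (crit k))" .
          have "(real (crit k) + 1) * b \<le> gain k \<eta>0 n l * b" using g by (intro mult_right_mono) auto
          moreover have "n * \<epsilon> * m = real m * (1 / (4 * real V))" using \<epsilon> by simp
          moreover have "real m * (1 / (2 * real V)) = real m * (1 / (4 * real V)) + real m * (1 / (4 * real V))"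
            by (simp add: field_simps)
          moreover have "\<kappa> * m \<le> real m * (1 / (4 * real V))"
            using mult_right_mono[OF \<kappa>(3), of "real m"] by (simp add: mult.commute)
          ultimately have 2: "real b * real (crit k) + (\<eta> * m + n * \<epsilon> * m - gain k \<eta>0 n l * b) \<le> (\<eta> - \<kappa>) * m"
            using bm by (simp add: algebra_simps)
          have "real_of_int (p ^ (b - 1)) ^ (crit k - crit l) * (C1 * ?P powr (\<eta> * m + n * \<epsilon> * m - gain k \<eta>0 n l * b))
             \<le> ?P powr (real b * real (crit k)) * (C * ?P powr (\<eta> * m + n * \<epsilon> * m - gain k \<eta>0 n l * b))"
            using 1 C C1 by (intro mult_mono mult_right_mono) auto
          also have "\<dots> = C * ?P powr (real b * real (crit k) + (\<eta> * m + n * \<epsilon> * m - gain k \<eta>0 n l * b))"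
            by (simp add: powr_add)
          also have "\<dots> \<le> C * ?P powr ((\<eta> - \<kappa>) * m)"
            using 2 C p1 by (intro mult_left_mono powr_mono) auto
          finally show "real_of_int (p ^ (b - 1)) ^ (crit k - crit l) * (C1 * ?P powr (\<eta> * m + n * \<epsilon> * m - gain k \<eta>0 n l * b))
             \<le> C * ?P powr ((\<eta> - \<kappa>) * m)" .
        qed
      qed
    qed
  qed
  then show ?thesis using \<kappa> by blast
qed

theorem dec_exp_all:
  assumes p: "prime p"
  shows "int k < p \<Longrightarrow> 1 \<le> k \<Longrightarrow> 0 < \<eta> \<Longrightarrow> dec_exp p k \<eta>"
proof (induction k arbitrary: \<eta> rule: less_induct)
  case (less k)
  show ?case
  proof (cases "k = 1")
    case True
    have "dec p 1 m (1 * real_of_int p powr (\<eta> * real m))" for m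
      by (rule dec_mono[OF dec_one[OF p]])
        (use p less.prems prime_gt_1_int[of p] in \<open>auto intro!: ge_one_powr_ge_zero\<close>)
    then show ?thesis unfolding True dec_exp_def by (intro exI[of _ 1]) auto
  next
    case False
    then have k2: "2 \<le> k" using less.prems by simp
    obtain \<kappa> where \<kappa>: "\<kappa> > 0" "\<And>\<zeta>. \<eta> \<le> \<zeta> \<Longrightarrow> dec_exp p k \<zeta> \<Longrightarrow> dec_exp p k (\<zeta> - \<kappa>)"
      using dec_exp_improve[OF p less.prems(1) k2 _ less.prems(3)] less.IH less.prems by fastforce
    \<comment> \<open>Descent by \<open>\<kappa>\<close> from the trivial exponent; the maximum
      stops it at \<open>\<eta>\<close>, the threshold down to which \<open>\<kappa>\<close> is
      available.\<close>
    have iter: "dec_exp p k (max \<eta> (real (crit k) - real j * \<kappa>))" for j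
    proof (induction j)
      case 0
      show ?case by (rule dec_exp_mono[OF p dec_exp_trivial[OF p less.prems(1,2)]]) simp
    next
      case (Suc j)
      show ?case
      proof (cases "\<eta> \<le> real (crit k) - real j * \<kappa>")
        case True
        then have "dec_exp p k (real (crit k) - real j * \<kappa> - \<kappa>)"
          using Suc \<kappa>(2) by (simp add: max_def)
        then show ?thesis by (rule dec_exp_mono[OF p]) (simp add: algebra_simps)
      next
        case False
        then have "dec_exp p k \<eta>" using Suc by (simp add: max_def)
        then show ?thesis by (rule dec_exp_mono[OF p]) simp
      qed
    qed
    obtain j :: nat where "real (crit k) / \<kappa> \<le> real j" using real_arch_simple by blast
    then have "real (crit k) \<le> real j * \<kappa>" using \<kappa>(1) by (simp add: pos_divide_le_eq)
    then show ?thesis using iter[of j] less.prems by (simp add: max_def split: if_splits)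
  qed
qed

section \<open>The mean value\<close>

text \<open>Only an inequality: modulo \<open>Q\<close>, orthogonality counts all pairs of tuples
  with congruent power sums, among them the solutions.\<close>

lemma J_le_avg:
  assumes Q: "Q > 0"
  shows "real (J s k X) \<le> avg k Q (\<lambda>x. energy k Q (monom 1) (\<lambda>_. 1) {1..\<lfloor>X\<rfloor>} x ^ s)"
proof -
  define Z where "Z = {1..s} \<rightarrow>\<^sub>E {1..\<lfloor>X\<rfloor>}"
  define g where "g = (\<lambda>j z. \<Sum>i=1..s. z i ^ j :: int)"
  have finZ: "finite Z" unfolding Z_def by (intro finite_PiE) auto
  have N: "{n. 1 \<le> n \<and> real_of_int n \<le> X} = {1..\<lfloor>X\<rfloor>}" by (auto simp: le_floor_iff)
  have pw: "expsum k Q (monom 1) (\<lambda>_. 1) {1..\<lfloor>X\<rfloor>} x ^ s = (\<Sum>z\<in>Z. 1 * add_char Q (\<Sum>j=1..k. x j * g j z))" for x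
  proof -
    have "expsum k Q (monom 1) (\<lambda>_. 1) {1..\<lfloor>X\<rfloor>} x ^ s =
      (\<Prod>i\<in>{1..s}. \<Sum>n\<in>{1..\<lfloor>X\<rfloor>}. add_char Q (\<Sum>j=1..k. x j * n ^ j))"
      by (simp add: expsum_def poly_monom)
    also have "\<dots> = (\<Sum>z\<in>Z. \<Prod>i\<in>{1..s}. add_char Q (\<Sum>j=1..k. x j * z i ^ j))"
      unfolding Z_def by (rule prod_sum_PiE) auto
    also have "\<dots> = (\<Sum>z\<in>Z. add_char Q (\<Sum>i=1..s. \<Sum>j=1..k. x j * z i ^ j))"
      by (simp only: add_char_sum)
    also have "\<dots> = (\<Sum>z\<in>Z. 1 * add_char Q (\<Sum>j=1..k. x j * g j z))"
      unfolding g_def sum_distrib_left by (subst sum.swap) simp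
    finally show ?thesis .
  qed
  define T where "T = {(z, z') \<in> Z \<times> Z. \<forall>j\<in>{1..k}. Q dvd g j z - g j z'}"
  have "finite T" unfolding T_def by (rule finite_subset[of _ "Z \<times> Z"]) (use finZ in auto)
  moreover have "vinogradov_solutions s k X \<subseteq> T"
    unfolding vinogradov_solutions_def N T_def Z_def g_def by auto
  ultimately have "J s k X \<le> card T" unfolding J_def by (rule card_mono)
  also have "real (card T) = Re (\<Sum>z\<in>Z. \<Sum>z'\<in>Z. if \<forall>j\<in>{1..k}. Q dvd g j z - g j z' then 1 * cnj 1 else 0)"
  proof -
    have "(\<Sum>z\<in>Z. \<Sum>z'\<in>Z. if \<forall>j\<in>{1..k}. Q dvd g j z - g j z' then 1 * cnj 1 else 0) =
      (\<Sum>w\<in>Z \<times> Z. if w \<in> T then 1 else (0::complex))"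
      unfolding sum.cartesian_product by (rule sum.cong[OF refl]) (auto simp: T_def split: if_splits)
    also have "\<dots> = (\<Sum>w\<in>T. 1)"
      by (rule sum.mono_neutral_cong_right) (use finZ in \<open>auto simp: T_def\<close>)
    finally show ?thesis by simp
  qed
  also have "\<dots> = avg k Q (\<lambda>x. (cmod (\<Sum>z\<in>Z. 1 * add_char Q (\<Sum>j=1..k. x j * g j z)))\<^sup>2)"
    by (rule avg_parseval[OF Q, symmetric])
  also have "\<dots> = avg k Q (\<lambda>x. energy k Q (monom 1) (\<lambda>_. 1) {1..\<lfloor>X\<rfloor>} x ^ s)"
    unfolding pw[symmetric] energy_def by (simp add: norm_power power_mult[symmetric] mult.commute)
  finally show ?thesis by simp
qed

lemma energy_le_card_squared:
  assumes "\<And>n. n \<in> N \<Longrightarrow> cmod (\<alpha> n) \<le> 1"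
  shows "energy k Q \<gamma> \<alpha> N x \<le> real (card N) ^ 2"
proof -
  have "cmod (expsum k Q \<gamma> \<alpha> N x) \<le> (\<Sum>n\<in>N. 1)"
    unfolding expsum_def using assms by (intro sum_norm_le) (simp add: norm_mult)
  then show ?thesis unfolding energy_def by (intro power_mono) auto
qed

text \<open>Since X \<le> p^m, the integers up to \<open>X\<close> lie in different classes modulo
  p^m. So the number of elements of a class, 0 or 1, is a valid bound \<open>d\<close>, and the
  bounds add up to at most \<open>X\<close>.\<close>

lemma mean_value_le:
  fixes p :: int
  assumes p: "prime p" and dec: "dec p k m K" and k: "1 \<le> k" and X: "1 \<le> X" "X \<le> real_of_int p ^ m" and K: "K \<ge> 0"
    and s: "crit k \<le> s"
  shows "real (J s k X) \<le> K * X ^ (2 * s - crit k)"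
proof -
  define Q where "Q = p ^ (k * m)"
  define N where "N = {1..\<lfloor>X\<rfloor>}"
  have p0: "p > 0" using p by (simp add: prime_gt_0_int)
  have Q0: "Q > 0" using p0 by (simp add: Q_def)
  have finN: "finite N" by (simp add: N_def)
  have cardN: "real (card N) \<le> X" using X by (simp add: N_def)
  define f where "f = energy k Q (monom 1) (\<lambda>_. 1) N"
  have cls1: "card (cls p m \<rho> N) \<le> 1" for \<rho>
  proof -
    have "\<lfloor>X\<rfloor> \<le> p ^ m" using X by (metis floor_mono floor_of_int of_int_power)
    have "a = b" if "a \<in> cls p m \<rho> N" "b \<in> cls p m \<rho> N" for a b
    proof -
      have "p ^ m dvd (a - \<rho>) - (b - \<rho>)" using that unfolding cls_def by (blast intro: dvd_diff)
      then have "p ^ m dvd (a - 1) - (b - 1)" by simp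
      then have "(a - 1) mod p ^ m = (b - 1) mod p ^ m" by (simp only: mod_eq_dvd_iff)
      moreover have "(a - 1) mod p ^ m = a - 1" "(b - 1) mod p ^ m = b - 1"
        using that \<open>\<lfloor>X\<rfloor> \<le> p ^ m\<close> by (auto simp: cls_def N_def intro!: mod_pos_pos_trivial)
      ultimately show ?thesis by simp
    qed
    then show ?thesis by (simp add: card_le_Suc0_iff_eq finN)
  qed
  have "avg k Q (\<lambda>x. f x ^ crit k) \<le> K * (\<Sum>\<rho>\<in>{0..<p^m}. real (card (cls p m \<rho> N))) ^ crit k"
    unfolding f_def Q_def
  proof (rule dec[unfolded dec_def, rule_format])
    show "curve p k (monom 1)" by (simp add: curve_def)
    show "finite N" by (rule finN)
    fix \<rho> assume "\<rho> \<in> {0..<p^m}"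
    have "energy k (p ^ (k * m)) (monom 1) (\<lambda>_. 1) (cls p m \<rho> N) x \<le> real (card (cls p m \<rho> N))" for x
    proof -
      have "energy k (p ^ (k * m)) (monom 1) (\<lambda>_. 1) (cls p m \<rho> N) x \<le> real (card (cls p m \<rho> N)) ^ 2"
        by (rule energy_le_card_squared) simp
      also have "\<dots> \<le> real (card (cls p m \<rho> N)) ^ 1"
        using cls1[of \<rho>] by (intro power_decreasing) auto
      finally show ?thesis by simp
    qed
    then have "avg k (p ^ (k * m)) (\<lambda>x. energy k (p ^ (k * m)) (monom 1) (\<lambda>_. 1) (cls p m \<rho> N) x ^ crit k)
        \<le> avg k (p ^ (k * m)) (\<lambda>x. real (card (cls p m \<rho> N)) ^ crit k)"
      using Q0 by (intro avg_mono power_mono) (auto simp: Q_def)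
    then show "0 \<le> real (card (cls p m \<rho> N)) \<and> avg k (p ^ (k * m)) (\<lambda>x. energy k (p ^ (k * m)) (monom 1) (\<lambda>_. 1) (cls p m \<rho> N) x ^ crit k)
        \<le> real (card (cls p m \<rho> N)) ^ crit k"
      using Q0 by (simp add: avg_const Q_def)
  qed
  also have "(\<Sum>\<rho>\<in>{0..<p^m}. real (card (cls p m \<rho> N))) = real (card N)"
    using sum_cls[OF p0 le0 finN, where c = m and t = 0 and f = "\<lambda>_. 1::real"] by simp
  also have "K * real (card N) ^ crit k \<le> K * X ^ crit k"
    using K cardN by (intro mult_left_mono power_mono) auto
  finally have main: "avg k Q (\<lambda>x. f x ^ crit k) \<le> K * X ^ crit k" .
  have "real (J s k X) \<le> avg k Q (\<lambda>x. f x ^ s)"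
    unfolding f_def N_def by (rule J_le_avg[OF Q0])
  also have "\<dots> \<le> avg k Q (\<lambda>x. (X ^ 2) ^ (s - crit k) * f x ^ crit k)"
  proof (rule avg_mono[OF Q0])
    fix x
    have "f x \<le> real (card N) ^ 2" unfolding f_def by (rule energy_le_card_squared) simp
    also have "\<dots> \<le> X ^ 2" using cardN by (intro power_mono) auto
    finally have "f x ^ (s - crit k) \<le> (X ^ 2) ^ (s - crit k)"
      unfolding f_def by (intro power_mono) auto
    then have "f x ^ (s - crit k) * f x ^ crit k \<le> (X ^ 2) ^ (s - crit k) * f x ^ crit k"
      by (rule mult_right_mono) (simp add: f_def)
    then show "f x ^ s \<le> (X ^ 2) ^ (s - crit k) * f x ^ crit k"
      using s by (simp flip: power_add)
  qed
  also have "\<dots> = (X ^ 2) ^ (s - crit k) * avg k Q (\<lambda>x. f x ^ crit k)" by (rule avg_cmult)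
  also have "\<dots> \<le> (X ^ 2) ^ (s - crit k) * (K * X ^ crit k)"
    by (intro mult_left_mono main) auto
  also have "\<dots> = K * X ^ (2 * (s - crit k) + crit k)"
    by (simp add: power_mult power_add)
  also have "2 * (s - crit k) + crit k = 2 * s - crit k" using s by simp
  finally show ?thesis .
qed

theorem vinogradov_mean_value:
  fixes s k :: nat and \<epsilon> :: real
  assumes k: "1 \<le> k" and s: "crit k \<le> s" and \<epsilon>: "\<epsilon> > 0"
  shows "(\<lambda>X. real (J s k X)) \<in> O[at_top](\<lambda>X. X powr (2 * real s - real (crit k) + \<epsilon>))"
proof -
  obtain q :: nat where q: "prime q" "q > k" using bigger_prime by blast
  define p where "p = int q"
  have p: "prime p" "int k < p" using q by (auto simp: p_def)
  define P where "P = real_of_int p"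
  have P1: "P > 1" using p(1) by (simp add: prime_gt_1_int P_def)
  obtain C where C: "C > 0" "\<And>m. dec p k m (C * P powr (\<epsilon> * real m))"
    using dec_exp_all[OF p k \<epsilon>] unfolding dec_exp_def P_def by blast
  have bound: "real (J s k X) \<le> C * P powr \<epsilon> * X powr (2 * real s - real (crit k) + \<epsilon>)" if X: "X \<ge> 1" for X
  proof -
    \<comment> \<open>The least natural number with X \<le> P^m; as P^m \<le> P X, rounding up costs
      only the factor \<open>P powr \<epsilon>\<close>.\<close>
    define m where "m = nat \<lceil>log P X\<rceil>"
    have logX: "log P X \<ge> 0" using X P1 by simp
    then have m: "log P X \<le> real m" "real m \<le> log P X + 1"
      unfolding m_def by linarith+
    have "X = P powr log P X" using X P1 by simp
    also have "\<dots> \<le> P powr real m" using m P1 by (intro powr_mono) auto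
    also have "\<dots> = P ^ m" using P1 by (simp add: powr_realpow)
    finally have Xm: "X \<le> real_of_int p ^ m" by (simp add: P_def)
    have "real (J s k X) \<le> C * P powr (\<epsilon> * real m) * X ^ (2 * s - crit k)"
      by (rule mean_value_le[OF p(1) C(2) k X Xm _ s]) (use C in simp)
    also have "X ^ (2 * s - crit k) = X powr (2 * real s - real (crit k))"
      using X s by (simp add: powr_realpow[symmetric] of_nat_diff)
    also have "C * P powr (\<epsilon> * real m) * X powr (2 * real s - real (crit k)) \<le>
        C * (P powr \<epsilon> * X powr \<epsilon>) * X powr (2 * real s - real (crit k))"
    proof (intro mult_right_mono mult_left_mono)
      have "P powr (\<epsilon> * real m) \<le> P powr (\<epsilon> * (log P X + 1))"
        using m P1 \<epsilon> by (intro powr_mono mult_left_mono) auto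
      also have "\<dots> = P powr \<epsilon> * (P powr log P X) powr \<epsilon>"
        by (simp add: distrib_left powr_add powr_powr mult.commute)
      also have "P powr log P X = X" using X P1 by simp
      finally show "P powr (\<epsilon> * real m) \<le> P powr \<epsilon> * X powr \<epsilon>" .
    qed (use C in auto)
    also have "\<dots> = C * P powr \<epsilon> * X powr (2 * real s - real (crit k) + \<epsilon>)"
      by (simp add: powr_add)
    finally show ?thesis .
  qed
  show ?thesis
  proof (rule bigoI[of _ "C * P powr \<epsilon>"])
    show "\<forall>\<^sub>F X in at_top. norm (real (J s k X)) \<le> C * P powr \<epsilon> * norm (X powr (2 * real s - real (crit k) + \<epsilon>))"
      using eventually_ge_at_top[of 1] by eventually_elim (use bound in auto)
  qed
qed

theorem corollary1p2:
  fixes s k :: nat and \<epsilon> :: real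
  assumes "k \<ge> 3" and "real s \<ge> real k ^ 2 - real k + 1" and "\<epsilon> > 0"
  shows "(\<lambda>X. real (J s k X))
           \<in> O[at_top](\<lambda>X. X powr (2 * real s - 1 / 2 * real k * (real k + 1) + \<epsilon>))"
proof -
  have "real (2 * crit k) = real (k * (k + 1))" by (simp only: two_crit)
  then have r: "real (crit k) = 1 / 2 * real k * (real k + 1)" by (simp add: field_simps)
  \<comment> \<open>Rearranged, this says that k (k + 1) / 2 \<le> k^2 - k + 1.\<close>
  have "0 \<le> (real k - 1) * (real k - 2)" using assms(1) by (intro mult_nonneg_nonneg) auto
  then have "real (crit k) \<le> real s"
    using assms(2) unfolding r by (simp add: algebra_simps power2_eq_square)
  then have "crit k \<le> s" by simp
  with vinogradov_mean_value[of k s \<epsilon>] show ?thesis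
    using assms(1,3) unfolding r by simp
qed

end
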